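(* Let $K$ be an algebraically closed field of characteristic $0$, let $N\ge k\ge 2$ and $d\ge 2$ be integers, let $b_1,\ldots,b_N\in K^*$, and let $P_{i+1}\in K[x_k,\ldots,x_i]$ for $k\le i\le N$ be polynomials with $\max_{k\le i\le N}\deg P_{i+1}=d$. Let $\bar f_{\boldsymbol P}:\mathbb{P}^N\dashrightarrow\mathbb{P}^N$ be the associated degree $d$ generalized Hénon map, i.e., the extension to a birational map of $\mathbb{P}^N$ of the affine automorphism $f_{\boldsymbol P}:\mathbb{A}^N\to\mathbb{A}^N$ given by \[ f_{\boldsymbol P}(x_1,\ldots,x_N)=\bigl(b_2x_2,\ldots,b_kx_k,\; b_{k+1}x_{k+1}+P_{k+1},\ldots,b_Nx_N+P_N,\; b_1x_1+P_{N+1}\bigr). \] Then: (a) If $d\ge 3$ or $k\ge 3$, then $\bar f_{\boldsymbol P}$ is in the $\operatorname{SL}_{N+1}$-unstable locus of $\operatorname{Rat}_d^N$. (b) If $d=k=2$, then $\bar f_{\boldsymbol P}$ is not in the $\operatorname{SL}_{N+1}$-stable locus of $\operatorname{Rat}_d^N$. (c) If $d=k=N=2$, then $\bar f_{\boldsymbol P}$ is in the $\operatorname{SL}_{N+1}$-semistable locus of $\operatorname{Rat}_d^N$.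
   Context: In the formula for $f_{\boldsymbol P}$, there are $k-1$ coordinates of the form $b_jx_j$ ($2\le j\le k$), then $N-k$ coordinates of the form $b_jx_j+P_j$ ($k+1\le j\le N$; none if $k=N$), then the last coordinate $b_1x_1+P_{N+1}$. Here $P_j\in K[x_k,\ldots,x_{j-1}]$. The extension $\bar f_{\boldsymbol P}$ is obtained by homogenizing to degree $d$ with a new variable $x_{N+1}$, with last coordinate $x_{N+1}^d$. Parameter space and action: let $V$ be the $K$-vector space of $(N+1)$-tuples $F=(F_1,\ldots,F_{N+1})$ of homogeneous polynomials of degree $d$ in $x_1,\ldots,x_{N+1}$, and let $\mathbb{P}^M=\mathbb{P}(V)$ be the projective space of lines in $V$. A degree $d$ rational map $\mathbb{P}^N\dashrightarrow\mathbb{P}^N$ is identified with the point $[F_1:\cdots:F_{N+1}]\in\mathbb{P}^M$ given by its coefficients, and $\operatorname{Rat}_d^N$ denotes the parameter space of such maps inside $\mathbb{P}^M$. The group $\operatorname{SL}_{N+1}$ acts linearly on $V$, hence on $\mathbb{P}^M$, by conjugation: $A\cdot F=A\circ F\circ A^{-1}$. Stability is in the sense of geometric invariant theory for this action of $\operatorname{SL}_{N+1}$, relative to the line bundle $\mathcal{O}_{\mathbb{P}^M}(1)$ with the linearization given by the linear action on $V$. A point is semistable if some non-constant homogeneous $\operatorname{SL}_{N+1}$-invariant polynomial on $V$ does not vanish at it. A point is unstable if it is not semistable. A point is stable if it is semistable, its stabilizer in $\operatorname{SL}_{N+1}$ is finite, and its orbit is closed in the semistable locus. *)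

theory Defs
  imports
    "HOL-Library.Poly_Mapping"
    "Jordan_Normal_Form.Determinant"
    "Jordan_Normal_Form.Gauss_Jordan_Elimination"
begin

section \<open>Multivariate polynomials\<close>

type_synonym ('v, 'a) mpoly = "('v \<Rightarrow>\<^sub>0 nat) \<Rightarrow>\<^sub>0 'a"

definition mconst :: "'a::zero \<Rightarrow> ('v, 'a) mpoly" where
  "mconst c = Poly_Mapping.single 0 c"

definition mvar :: "'v \<Rightarrow> ('v, 'a::zero_neq_one) mpoly" where
  "mvar v = Poly_Mapping.single (Poly_Mapping.single v 1) 1"

definition mon_degree :: "('v \<Rightarrow>\<^sub>0 nat) \<Rightarrow> nat" where
  "mon_degree m = (\<Sum>v\<in>Poly_Mapping.keys m. Poly_Mapping.lookup m v)"

text \<open>The zero polynomial has total degree 0.\<close>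

definition total_degree :: "('v, 'a::zero) mpoly \<Rightarrow> nat" where
  "total_degree p = Max (insert 0 (mon_degree ` Poly_Mapping.keys p))"

definition mpoly_vars :: "('v, 'a::zero) mpoly \<Rightarrow> 'v set" where
  "mpoly_vars p = (\<Union>m\<in>Poly_Mapping.keys p. Poly_Mapping.keys m)"

text \<open>The zero polynomial is homogeneous of every degree.\<close>

definition homogeneous :: "nat \<Rightarrow> ('v, 'a::zero) mpoly \<Rightarrow> bool" where
  "homogeneous e p \<longleftrightarrow> (\<forall>m\<in>Poly_Mapping.keys p. mon_degree m = e)"

text \<open>Coefficients are mapped by \<open>h\<close>, variables by \<open>x\<close>: with \<open>h = id\<close> this is evaluation at
  a point, with \<open>h = mconst\<close> it is substitution of polynomials for the variables.\<close>

definition mpoly_eval ::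
    "('a::zero \<Rightarrow> 'b::comm_semiring_1) \<Rightarrow> ('v \<Rightarrow> 'b) \<Rightarrow> ('v, 'a) mpoly \<Rightarrow> 'b" where
  "mpoly_eval h x p =
     (\<Sum>m\<in>Poly_Mapping.keys p. h (Poly_Mapping.lookup p m) *
        (\<Prod>v\<in>Poly_Mapping.keys m. x v ^ Poly_Mapping.lookup m v))"

text \<open>Homogenization to degree \<open>d\<close> with new variable \<open>v\<close>; meaningful if
  \<open>total_degree p \<le> d\<close> and \<open>v\<close> does not occur in \<open>p\<close>.\<close>

definition homogenize :: "nat \<Rightarrow> 'v \<Rightarrow> ('v, 'a::comm_monoid_add) mpoly \<Rightarrow> ('v, 'a) mpoly" where
  "homogenize d v p =
     (\<Sum>m\<in>Poly_Mapping.keys p.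
        Poly_Mapping.single (m + Poly_Mapping.single v (d - mon_degree m)) (Poly_Mapping.lookup p m))"


section \<open>The parameter space and the conjugation action\<close>

text \<open>A tuple $(F_1,\ldots,F_{N+1})$ is a function on the natural numbers that is zero outside
  \<open>{1..N+1}\<close>.\<close>

type_synonym 'a tuple = "nat \<Rightarrow> (nat, 'a) mpoly"

definition form_tuples :: "nat \<Rightarrow> nat \<Rightarrow> 'a::zero tuple set" where
  "form_tuples N d =
     {F. (\<forall>i\<in>{1..N+1}. homogeneous d (F i) \<and> mpoly_vars (F i) \<subseteq> {1..N+1}) \<and>
         (\<forall>i. i \<notin> {1..N+1} \<longrightarrow> F i = 0)}"

definition line :: "'a::field tuple \<Rightarrow> 'a tuple set" where
  "line F = {(\<lambda>i. mconst c * F i) |c. True}"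

definition proj_space :: "nat \<Rightarrow> nat \<Rightarrow> 'a::field tuple set set" where
  "proj_space N d = {line F |F. F \<in> form_tuples N d \<and> F \<noteq> (\<lambda>_. 0)}"

text \<open>A point of the projective space defines a rational map of degree exactly \<open>d\<close> iff its
  coordinate forms have no non-constant common factor.\<close>

definition Rat_space :: "nat \<Rightarrow> nat \<Rightarrow> 'a::field tuple set set" where
  "Rat_space N d =
     {line F |F. F \<in> form_tuples N d \<and> F \<noteq> (\<lambda>_. 0) \<and>
        (\<forall>G. (\<forall>i\<in>{1..N+1}. G dvd F i) \<longrightarrow> G dvd 1)}"

definition SL :: "nat \<Rightarrow> 'a::field mat set" where
  "SL n = {A \<in> carrier_mat n n. det A = 1}"

text \<open>Matrices are indexed from 0, coordinates and variables from 1.\<close>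

definition linear_form :: "nat \<Rightarrow> 'a::field mat \<Rightarrow> nat \<Rightarrow> (nat, 'a) mpoly" where
  "linear_form N B i = (\<Sum>j\<in>{1..N+1}. mconst (B $$ (i - 1, j - 1)) * mvar j)"

text \<open>$A \cdot F = A \circ F \circ A^{-1}$\<close>

definition conj_action :: "nat \<Rightarrow> 'a::field mat \<Rightarrow> 'a tuple \<Rightarrow> 'a tuple" where
  "conj_action N A F = (\<lambda>i. if i \<in> {1..N+1}
     then \<Sum>j\<in>{1..N+1}. mconst (A $$ (i - 1, j - 1)) *
            mpoly_eval mconst (linear_form N (the (mat_inverse A))) (F j)
     else 0)"

definition proj_action :: "nat \<Rightarrow> 'a::field mat \<Rightarrow> 'a tuple set \<Rightarrow> 'a tuple set" where
  "proj_action N A p = conj_action N A ` p"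


section \<open>Stability\<close>

text \<open>The coordinate \<open>(i, m)\<close> on the space of tuples is the coefficient of the monomial \<open>m\<close>
  in the \<open>i\<close>-th form.\<close>

type_synonym 'a coord_poly = "(nat \<times> (nat \<Rightarrow>\<^sub>0 nat), 'a) mpoly"

definition coord_polys :: "nat \<Rightarrow> nat \<Rightarrow> 'a::zero coord_poly set" where
  "coord_polys N d =
     {J. mpoly_vars J \<subseteq>
           {1..N+1} \<times> {m. Poly_Mapping.keys m \<subseteq> {1..N+1} \<and> mon_degree m = d}}"

definition value_at :: "'a::field coord_poly \<Rightarrow> 'a tuple \<Rightarrow> 'a" where
  "value_at J F = mpoly_eval id (\<lambda>(i, m). Poly_Mapping.lookup (F i) m) J"

definition vanishes_at :: "'a::field coord_poly \<Rightarrow> 'a tuple set \<Rightarrow> bool" where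
  "vanishes_at J p \<longleftrightarrow> (\<forall>F\<in>p. value_at J F = 0)"

definition SL_invariant :: "nat \<Rightarrow> nat \<Rightarrow> 'a::field coord_poly \<Rightarrow> bool" where
  "SL_invariant N d J \<longleftrightarrow>
     (\<forall>A\<in>SL (N+1). \<forall>F\<in>form_tuples N d. value_at J (conj_action N A F) = value_at J F)"

definition semistable_locus :: "nat \<Rightarrow> nat \<Rightarrow> 'a::field tuple set set" where
  "semistable_locus N d =
     {p \<in> proj_space N d. \<exists>J\<in>coord_polys N d.
        (\<exists>e. homogeneous e J) \<and> (\<nexists>c. J = mconst c) \<and> SL_invariant N d J \<and> \<not> vanishes_at J p}"

definition unstable_locus :: "nat \<Rightarrow> nat \<Rightarrow> 'a::field tuple set set" where
  "unstable_locus N d = proj_space N d - semistable_locus N d"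

definition zariski_closed :: "nat \<Rightarrow> nat \<Rightarrow> 'a::field tuple set set \<Rightarrow> bool" where
  "zariski_closed N d Z \<longleftrightarrow>
     (\<exists>S\<subseteq>{J \<in> coord_polys N d. \<exists>e. homogeneous e J}.
        Z = {p \<in> proj_space N d. \<forall>J\<in>S. vanishes_at J p})"

definition SL_stabilizer :: "nat \<Rightarrow> 'a::field tuple set \<Rightarrow> 'a mat set" where
  "SL_stabilizer N p = {A \<in> SL (N+1). proj_action N A p = p}"

definition SL_orbit :: "nat \<Rightarrow> 'a::field tuple set \<Rightarrow> 'a tuple set set" where
  "SL_orbit N p = (\<lambda>A. proj_action N A p) ` SL (N+1)"

definition stable_locus :: "nat \<Rightarrow> nat \<Rightarrow> 'a::field tuple set set" where
  "stable_locus N d =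
     {p \<in> semistable_locus N d. finite (SL_stabilizer N p) \<and>
        (\<exists>Z. zariski_closed N d Z \<and> SL_orbit N p = Z \<inter> semistable_locus N d)}"


section \<open>Generalized Henon maps\<close>

definition henon_affine ::
    "nat \<Rightarrow> nat \<Rightarrow> (nat \<Rightarrow> 'a::field) \<Rightarrow> (nat \<Rightarrow> (nat, 'a) mpoly) \<Rightarrow> nat \<Rightarrow> (nat, 'a) mpoly" where
  "henon_affine N k b P i =
     (if i < k then mconst (b (i+1)) * mvar (i+1)
      else if i < N then mconst (b (i+1)) * mvar (i+1) + P (i+1)
      else mconst (b 1) * mvar 1 + P (N+1))"

definition henon_tuple ::
    "nat \<Rightarrow> nat \<Rightarrow> nat \<Rightarrow> (nat \<Rightarrow> 'a::field) \<Rightarrow> (nat \<Rightarrow> (nat, 'a) mpoly) \<Rightarrow> 'a tuple" where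
  "henon_tuple N k d b P i =
     (if i \<in> {1..N} then homogenize d (N+1) (henon_affine N k b P i)
      else if i = N+1 then mvar (N+1) ^ d
      else 0)"

definition henon_point ::
    "nat \<Rightarrow> nat \<Rightarrow> nat \<Rightarrow> (nat \<Rightarrow> 'a::field) \<Rightarrow> (nat \<Rightarrow> (nat, 'a) mpoly) \<Rightarrow> 'a tuple set" where
  "henon_point N k d b P = line (henon_tuple N k d b P)"

end

theory Submission
  imports Defs
begin

text \<open>Instability and non-stability come from the Hilbert--Mumford criterion: along a diagonal
  one-parameter subgroup that acts on the monomials of \<open>F\<close> with nonnegative weights, every
  coordinate polynomial is a polynomial in the parameter, so an invariant has the same value at
  \<open>F\<close> and at the weight zero part of \<open>F\<close>. If all weights are positive that part is 0; if they
  are nonnegative, a stable orbit would contain a point fixed by the whole subgroup.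

  Semistability is witnessed by an explicit invariant of quadratic maps. The divergence of \<open>F\<close> is a
  linear form; its composition with \<open>F\<close> is a quadratic form attached equivariantly to \<open>F\<close>, so its
  discriminant is invariant. For a quadratic Henon map of the plane the Gram matrix of this
  quadratic form is anti-triangular with nonzero antidiagonal.\<close>

section \<open>Evaluation and substitution\<close>

text \<open>Only the elementary half of the criterion is needed: one suitable subgroup settles (a),
  and one settles (b). The difficulty in (a) is the choice of weights. A very negative weight on
  \<open>x_(N+1)\<close> makes almost every monomial favourable, but the weights must sum to zero,
  so the first \<open>k - 1\<close> variables carry the compensation, and these variables return in
  the linear terms \<open>x_j * x_(N+1)^(d-1)\<close>. The two demands are compatible for the chosen
  weights once \<open>(d - 1) * (k - 1) \<ge> 2\<close>. In the borderline case
  \<open>d = k = 2\<close> the monomial \<open>x_1 * x_(N+1)\<close> and the quadratic terms of the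
  \<open>P_j\<close> are left at weight zero. For (c) the definition of semistability asks for an
  actual polynomial in the coefficients. The discriminant is therefore built twice, as a number
  attached to a tuple and as a determinant of generic entries; evaluation, being a ring
  homomorphism, links the two. Membership in \<open>Rat_space\<close> is a separate matter: a common
  factor divides the last coordinate \<open>x_(N+1)^d\<close>, so primality of a variable decides
  it.\<close>

definition mon_eval :: "('v \<Rightarrow> 'b::comm_semiring_1) \<Rightarrow> ('v \<Rightarrow>\<^sub>0 nat) \<Rightarrow> 'b" where
  "mon_eval x m = (\<Prod>v\<in>Poly_Mapping.keys m. x v ^ Poly_Mapping.lookup m v)"

lemma mon_eval_superset:
  assumes "finite S" "Poly_Mapping.keys m \<subseteq> S"
  shows "mon_eval x m = (\<Prod>v\<in>S. x v ^ Poly_Mapping.lookup m v)"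
  unfolding mon_eval_def by (rule prod.mono_neutral_left) (use assms in \<open>auto simp: in_keys_iff\<close>)

lemma mon_eval_add: "mon_eval x (m + n) = mon_eval x m * mon_eval x n"
proof -
  let ?S = "Poly_Mapping.keys m \<union> Poly_Mapping.keys n"
  have "mon_eval x (m + n) = (\<Prod>v\<in>?S. x v ^ Poly_Mapping.lookup (m + n) v)"
    by (rule mon_eval_superset) (use keys_add[of m n] in auto)
  also have "\<dots> = (\<Prod>v\<in>?S. x v ^ Poly_Mapping.lookup m v) * (\<Prod>v\<in>?S. x v ^ Poly_Mapping.lookup n v)"
    by (simp add: lookup_add power_add prod.distrib)
  also have "\<dots> = mon_eval x m * mon_eval x n"
    by (subst (1 2) mon_eval_superset[of ?S]) auto
  finally show ?thesis .
qed

lemma mon_eval_zero [simp]: "mon_eval x 0 = 1"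
  by (simp add: mon_eval_def)

lemma mon_eval_single [simp]: "mon_eval x (Poly_Mapping.single v n) = x v ^ n"
  by (simp add: mon_eval_def)

lemma mon_degree_superset:
  assumes "finite S" "Poly_Mapping.keys m \<subseteq> S"
  shows "mon_degree m = (\<Sum>v\<in>S. Poly_Mapping.lookup m v)"
  unfolding mon_degree_def by (rule sum.mono_neutral_left) (use assms in \<open>auto simp: in_keys_iff\<close>)

lemma mon_degree_add [simp]: "mon_degree (m + n) = mon_degree m + mon_degree n"
proof -
  let ?S = "Poly_Mapping.keys m \<union> Poly_Mapping.keys n"
  have "mon_degree (m + n) = (\<Sum>v\<in>?S. Poly_Mapping.lookup (m + n) v)"
    by (rule mon_degree_superset) (use keys_add[of m n] in auto)
  also have "\<dots> = (\<Sum>v\<in>?S. Poly_Mapping.lookup m v) + (\<Sum>v\<in>?S. Poly_Mapping.lookup n v)"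
    by (simp add: lookup_add sum.distrib)
  also have "\<dots> = mon_degree m + mon_degree n"
    by (subst (1 2) mon_degree_superset[of ?S]) auto
  finally show ?thesis .
qed

lemma mon_degree_zero [simp]: "mon_degree 0 = 0"
  by (simp add: mon_degree_def)

lemma mon_degree_single [simp]: "mon_degree (Poly_Mapping.single v n) = n"
  by (simp add: mon_degree_def)

lemma mon_degree_eq_0_iff [simp]: "mon_degree m = 0 \<longleftrightarrow> m = 0"
  by (auto simp: mon_degree_def in_keys_iff intro!: poly_mapping_eqI)

lemma poly_mapping_eq_sum_single:
  fixes p :: "'k \<Rightarrow>\<^sub>0 'c::comm_monoid_add"
  shows "p = (\<Sum>k\<in>Poly_Mapping.keys p. Poly_Mapping.single k (Poly_Mapping.lookup p k))"
proof (rule poly_mapping_eqI)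
  fix k
  have "Poly_Mapping.lookup (\<Sum>k\<in>Poly_Mapping.keys p. Poly_Mapping.single k (Poly_Mapping.lookup p k)) k
      = (\<Sum>j\<in>Poly_Mapping.keys p. if j = k then Poly_Mapping.lookup p j else 0)"
    by (simp add: lookup_sum lookup_single when_def)
  then show "Poly_Mapping.lookup p k =
      Poly_Mapping.lookup (\<Sum>k\<in>Poly_Mapping.keys p. Poly_Mapping.single k (Poly_Mapping.lookup p k)) k"
    by (auto simp: in_keys_iff)
qed

lemma mpoly_eval_alt:
  "mpoly_eval h x p = (\<Sum>m\<in>Poly_Mapping.keys p. h (Poly_Mapping.lookup p m) * mon_eval x m)"
  by (simp add: mpoly_eval_def mon_eval_def)

lemma mpoly_eval_cong:
  assumes "\<And>v. v \<in> mpoly_vars p \<Longrightarrow> x v = y v"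
  shows "mpoly_eval h x p = mpoly_eval h y p"
  unfolding mpoly_eval_def
proof (intro sum.cong refl arg_cong2[where f = "(*)"] prod.cong)
  fix m v assume "m \<in> Poly_Mapping.keys p" "v \<in> Poly_Mapping.keys m"
  then have "v \<in> mpoly_vars p" by (auto simp: mpoly_vars_def)
  then show "x v ^ Poly_Mapping.lookup m v = y v ^ Poly_Mapping.lookup m v"
    by (simp add: assms)
qed

context comm_ring_hom
begin

lemma mpoly_eval_single: "mpoly_eval hom x (Poly_Mapping.single m c) = hom c * mon_eval x m"
  by (simp add: mpoly_eval_alt)

lemma mpoly_eval_add: "mpoly_eval hom x (p + q) = mpoly_eval hom x p + mpoly_eval hom x q"
  unfolding mpoly_eval_alt
  by (rule setsum_keys_plus_distrib[where f = "\<lambda>m c. hom c * mon_eval x m"])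
     (auto simp: hom_distribs algebra_simps)

lemma mpoly_eval_sum: "mpoly_eval hom x (sum f S) = (\<Sum>s\<in>S. mpoly_eval hom x (f s))"
proof (induction S rule: infinite_finite_induct)
  case (insert s S)
  then show ?case by (simp add: mpoly_eval_add)
qed (simp_all add: mpoly_eval_alt)

lemma mpoly_eval_mult: "mpoly_eval hom x (p * q) = mpoly_eval hom x p * mpoly_eval hom x q"
proof -
  have "mpoly_eval hom x (p * q) = mpoly_eval hom x
      ((\<Sum>k\<in>Poly_Mapping.keys p. Poly_Mapping.single k (Poly_Mapping.lookup p k)) *
       (\<Sum>k\<in>Poly_Mapping.keys q. Poly_Mapping.single k (Poly_Mapping.lookup q k)))"
    using poly_mapping_eq_sum_single[of p] poly_mapping_eq_sum_single[of q] by simp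
  also have "\<dots> = (\<Sum>k\<in>Poly_Mapping.keys p. \<Sum>l\<in>Poly_Mapping.keys q.
      (hom (Poly_Mapping.lookup p k) * mon_eval x k) * (hom (Poly_Mapping.lookup q l) * mon_eval x l))"
    unfolding sum_product mpoly_eval_sum mult_single mpoly_eval_single mon_eval_add hom_mult
    by (simp only: mult_ac)
  also have "\<dots> = mpoly_eval hom x p * mpoly_eval hom x q"
    by (simp add: mpoly_eval_alt sum_product)
  finally show ?thesis .
qed

text \<open>One statement serves both evaluation at a point (\<open>id\<close>) and substitution of
  polynomials (\<open>mconst\<close>). Interpreting it gives all homomorphism rules at once,
  including the one for determinants used for the discriminant.\<close>

lemma comm_ring_hom_mpoly_eval: "comm_ring_hom (mpoly_eval hom x)"
proof
  show "mpoly_eval hom x 1 = 1"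
    using mpoly_eval_single[of x 0 1] by simp
  show "mpoly_eval hom x 0 = 0"
    by (simp add: mpoly_eval_alt)
qed (simp_all add: mpoly_eval_add mpoly_eval_mult)

lemma mpoly_eval_mconst [simp]: "mpoly_eval hom x (mconst c) = hom c"
  by (simp add: mconst_def mpoly_eval_single)

lemma mpoly_eval_mvar [simp]: "mpoly_eval hom x (mvar v) = x v"
  by (simp add: mvar_def mpoly_eval_single)

lemma mpoly_eval_mpoly_eval:
  "mpoly_eval hom x (mpoly_eval mconst y p) = mpoly_eval hom (\<lambda>v. mpoly_eval hom x (y v)) p"
proof -
  interpret e: comm_ring_hom "mpoly_eval hom x" by (rule comm_ring_hom_mpoly_eval)
  show ?thesis
    by (subst (2 3) mpoly_eval_def) (simp add: e.hom_sum e.hom_mult e.hom_prod e.hom_power)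
qed

end

lemma comm_ring_hom_mconst: "comm_ring_hom (mconst :: 'a::comm_ring_1 \<Rightarrow> ('v, 'a) mpoly)"
  by unfold_locales (simp_all add: mconst_def single_add mult_single)

lemma comm_ring_hom_id: "comm_ring_hom (id :: 'a::comm_ring_1 \<Rightarrow> 'a)"
  by unfold_locales simp_all

interpretation mconst: comm_ring_hom "mconst :: 'a::comm_ring_1 \<Rightarrow> ('v, 'a) mpoly"
  by (rule comm_ring_hom_mconst)

lemma lookup_mconst_mult [simp]:
  fixes c :: "'a::comm_ring_1"
  shows "Poly_Mapping.lookup (mconst c * p) m = c * Poly_Mapping.lookup p m"
proof -
  have "mconst c * p = Poly_Mapping.map ((*) c) p"
    unfolding mconst_def by (rule mult_map_scale_conv_mult[symmetric])
  then show ?thesis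
    by (simp add: map.rep_eq when_def)
qed

lemma mconst_mult_single:
  fixes c :: "'a::comm_ring_1"
  shows "mconst c * Poly_Mapping.single m a = Poly_Mapping.single m (c * a)"
  by (simp add: mconst_def mult_single)

lemma prod_single:
  fixes g :: "'i \<Rightarrow> 'a::comm_ring_1" and f :: "'i \<Rightarrow> 'm::comm_monoid_add"
  shows "finite S \<Longrightarrow> (\<Prod>i\<in>S. Poly_Mapping.single (f i) (g i)) =
    Poly_Mapping.single (\<Sum>i\<in>S. f i) (\<Prod>i\<in>S. g i)"
  by (induction S rule: finite_induct) (simp_all add: mult_single)

lemma mvar_power: "mvar v ^ n = Poly_Mapping.single (Poly_Mapping.single v n) (1::'a::comm_ring_1)"
  by (induction n) (simp_all add: mvar_def mult_single single_add[symmetric])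

lemma mon_eval_diag:
  "mon_eval (\<lambda>w. mconst (c w) * mvar w) m = Poly_Mapping.single m (mon_eval c m :: 'a::comm_ring_1)"
proof -
  have "mon_eval (\<lambda>w. mconst (c w) * mvar w) m =
     (\<Prod>v\<in>Poly_Mapping.keys m. Poly_Mapping.single
        (Poly_Mapping.single v (Poly_Mapping.lookup m v)) (c v ^ Poly_Mapping.lookup m v))"
    unfolding mon_eval_def
    by (simp add: power_mult_distrib mvar_power mconst.hom_power[symmetric] mconst_mult_single)
  also have "\<dots> = Poly_Mapping.single m (mon_eval c m)"
    using poly_mapping_eq_sum_single[of m] by (simp add: prod_single mon_eval_def)
  finally show ?thesis .
qed

text \<open>A diagonal substitution rescales monomials without mixing them. The scalars may vanish:
  nonzero ones give the torus action, and a single zero gives the projection behind the primality of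
  a variable.\<close>

lemma lookup_diag_subst:
  fixes p :: "('v, 'a::comm_ring_1) mpoly"
  shows "Poly_Mapping.lookup (mpoly_eval mconst (\<lambda>w. mconst (c w) * mvar w) p) m =
    Poly_Mapping.lookup p m * mon_eval c m"
proof -
  have "Poly_Mapping.lookup (mpoly_eval mconst (\<lambda>w. mconst (c w) * mvar w) p) m =
     (\<Sum>k\<in>Poly_Mapping.keys p. if k = m then Poly_Mapping.lookup p k * mon_eval c k else 0)"
    by (simp add: mpoly_eval_alt mon_eval_diag mconst_mult_single lookup_sum lookup_single when_def)
  then show ?thesis
    by (auto simp: in_keys_iff)
qed

section \<open>Homogeneity and occurring variables\<close>

lemma homogeneous_zero [simp]: "homogeneous e 0"
  by (simp add: homogeneous_def)

lemma homogeneous_add: "homogeneous e p \<Longrightarrow> homogeneous e q \<Longrightarrow> homogeneous e (p + q)"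
  using keys_add[of p q] by (auto simp: homogeneous_def)

lemma homogeneous_sum: "(\<And>s. s \<in> S \<Longrightarrow> homogeneous e (f s)) \<Longrightarrow> homogeneous e (sum f S)"
  by (induction S rule: infinite_finite_induct) (auto intro: homogeneous_add)

lemma homogeneous_mult:
  "homogeneous e p \<Longrightarrow> homogeneous f q \<Longrightarrow> homogeneous (e + f) (p * q)"
  using keys_mult[of p q] by (fastforce simp: homogeneous_def)

lemma homogeneous_mconst [simp]: "homogeneous 0 (mconst c)"
  by (simp add: homogeneous_def mconst_def)

lemma homogeneous_mvar [simp]: "homogeneous 1 (mvar v)"
  by (simp add: homogeneous_def mvar_def)

lemma mpoly_vars_zero [simp]: "mpoly_vars 0 = {}"
  by (simp add: mpoly_vars_def)

lemma mpoly_vars_add: "mpoly_vars (p + q) \<subseteq> mpoly_vars p \<union> mpoly_vars q"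
  using keys_add[of p q] by (auto simp: mpoly_vars_def)

lemma mpoly_vars_sum: "mpoly_vars (sum f S) \<subseteq> (\<Union>s\<in>S. mpoly_vars (f s))"
proof (induction S rule: infinite_finite_induct)
  case (insert s S)
  then show ?case using mpoly_vars_add[of "f s" "sum f S"] by auto
qed auto

lemma mpoly_vars_mult: "mpoly_vars (p * q) \<subseteq> mpoly_vars p \<union> mpoly_vars q"
proof
  fix v assume "v \<in> mpoly_vars (p * q)"
  then obtain m where m: "m \<in> Poly_Mapping.keys (p * q)" "v \<in> Poly_Mapping.keys m"
    by (auto simp: mpoly_vars_def)
  then obtain k l where "k \<in> Poly_Mapping.keys p" "l \<in> Poly_Mapping.keys q" "m = k + l"
    using keys_mult[of p q] by blast
  with m show "v \<in> mpoly_vars p \<union> mpoly_vars q"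
    using keys_add[of k l] by (auto simp: mpoly_vars_def)
qed

lemma mpoly_vars_mconst [simp]: "mpoly_vars (mconst c) = {}"
  by (simp add: mpoly_vars_def mconst_def)

lemma mpoly_vars_mvar [simp]: "mpoly_vars (mvar v) = {v}"
  by (simp add: mpoly_vars_def mvar_def)

lemma homogeneous_0_imp_mconst:
  assumes "homogeneous 0 p"
  shows "p = mconst (Poly_Mapping.lookup p 0)"
proof (rule poly_mapping_eqI)
  fix m
  show "Poly_Mapping.lookup p m = Poly_Mapping.lookup (mconst (Poly_Mapping.lookup p 0)) m"
  proof (cases "m = 0")
    case False
    then have "m \<notin> Poly_Mapping.keys p" using assms by (auto simp: homogeneous_def)
    with False show ?thesis by (simp add: mconst_def lookup_single in_keys_iff)
  qed (simp add: mconst_def)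
qed

section \<open>Variables are prime\<close>

lemma mvar_dvd_iff:
  fixes p :: "('v, 'a::comm_ring_1) mpoly"
  shows "mvar v dvd p \<longleftrightarrow> (\<forall>m\<in>Poly_Mapping.keys p. Poly_Mapping.lookup m v \<noteq> 0)"
proof
  assume "mvar v dvd p"
  then obtain q where q: "p = mvar v * q" by auto
  show "\<forall>m\<in>Poly_Mapping.keys p. Poly_Mapping.lookup m v \<noteq> 0"
  proof
    fix m assume "m \<in> Poly_Mapping.keys p"
    then obtain k l where "k \<in> Poly_Mapping.keys (mvar v :: ('v, 'a) mpoly)" "m = k + l"
      using keys_mult[of "mvar v" q] q by blast
    then show "Poly_Mapping.lookup m v \<noteq> 0" by (auto simp: mvar_def lookup_add split: if_splits)
  qed
next
  assume *: "\<forall>m\<in>Poly_Mapping.keys p. Poly_Mapping.lookup m v \<noteq> 0"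
  have "mvar v dvd Poly_Mapping.single m (Poly_Mapping.lookup p m)" if "m \<in> Poly_Mapping.keys p" for m
  proof
    have "Poly_Mapping.single v 1 + (m - Poly_Mapping.single v 1) = m"
      using * that by (intro poly_mapping_eqI) (auto simp: lookup_add lookup_minus lookup_single when_def)
    then show "Poly_Mapping.single m (Poly_Mapping.lookup p m) =
        mvar v * Poly_Mapping.single (m - Poly_Mapping.single v 1) (Poly_Mapping.lookup p m)"
      by (simp add: mvar_def mult_single)
  qed
  then show "mvar v dvd p"
    by (subst poly_mapping_eq_sum_single) (rule dvd_sum)
qed

text \<open>Setting \<open>v\<close> to 0 is a ring endomorphism whose kernel consists of the
  multiples of \<open>mvar v\<close>, and its values lie in a ring without zero divisors. The
  \<open>linorder\<close> sort is what makes the polynomial ring an instance of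
  \<open>idom\<close>.\<close>

lemma mvar_dvd_multD:
  fixes p q :: "('v::linorder, 'a::idom) mpoly"
  assumes "mvar v dvd p * q"
  shows "mvar v dvd p \<or> mvar v dvd q"
proof -
  define c :: "'v \<Rightarrow> 'a" where "c = (\<lambda>w. if w = v then 0 else 1)"
  define \<phi> where "\<phi> = mpoly_eval mconst (\<lambda>w. mconst (c w) * mvar w)"
  interpret \<phi>: comm_ring_hom \<phi>
    unfolding \<phi>_def by (rule mconst.comm_ring_hom_mpoly_eval)
  have c: "mon_eval c m = 0 \<longleftrightarrow> Poly_Mapping.lookup m v \<noteq> 0" for m
    by (auto simp: mon_eval_def c_def in_keys_iff)
  have dvd: "mvar v dvd r \<longleftrightarrow> \<phi> r = 0" for r
  proof -
    have "\<phi> r = 0 \<longleftrightarrow> (\<forall>m. Poly_Mapping.lookup r m * mon_eval c m = 0)"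
      by (simp add: poly_mapping_eq_iff fun_eq_iff \<phi>_def lookup_diag_subst)
    then show ?thesis by (auto simp: mvar_dvd_iff c in_keys_iff)
  qed
  show ?thesis using assms unfolding dvd by (simp add: \<phi>.hom_mult)
qed

text \<open>If \<open>v\<close> does not divide \<open>G\<close>, primality puts a factor
  \<open>v\<close> into the cofactor, where it cancels; this lowers the exponent.\<close>

lemma dvd_mvar_power_cases:
  fixes G :: "('v::linorder, 'a::idom) mpoly"
  assumes "G dvd mvar v ^ n"
  shows "G dvd 1 \<or> mvar v dvd G"
  using assms
proof (induction n)
  case (Suc n)
  then obtain H where H: "mvar v * mvar v ^ n = G * H" by auto
  have nz: "(mvar v :: ('v, 'a) mpoly) \<noteq> 0"
    by (metis mvar_def single_one lookup_single_eq lookup_zero zero_neq_one)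
  have "mvar v dvd G * H" using H by (metis dvd_triv_left)
  then show ?case
  proof (cases "mvar v dvd G")
    case False
    with mvar_dvd_multD[OF \<open>mvar v dvd G * H\<close>] obtain H' where "H = mvar v * H'" by auto
    with H have "mvar v * mvar v ^ n = mvar v * (G * H')" by (simp add: mult_ac)
    with nz have "mvar v ^ n = G * H'" by simp
    then have "G dvd mvar v ^ n" by simp
    then show ?thesis by (rule Suc.IH)
  qed simp
qed simp

section \<open>The conjugation action\<close>

lemma SL_mat_inverse:
  assumes "A \<in> SL n"
  defines "B \<equiv> the (mat_inverse A)"
  shows "B \<in> carrier_mat n n" "A * B = 1\<^sub>m n" "B * A = 1\<^sub>m n" "B \<in> SL n"
proof -
  have A: "A \<in> carrier_mat n n" "det A = 1" using assms by (auto simp: SL_def)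
  have "A \<in> Units (ring_mat TYPE('a) n ())" using det_non_zero_imp_unit[OF A(1)] A(2) by simp
  then have "mat_inverse A \<noteq> None" using mat_inverse(1)[OF A(1), of "()"] by auto
  then have "mat_inverse A = Some B" by (auto simp: B_def)
  from mat_inverse(2)[OF A(1) this]
  show B: "B \<in> carrier_mat n n" "A * B = 1\<^sub>m n" "B * A = 1\<^sub>m n" by auto
  have "det A * det B = det (1\<^sub>m n)" using det_mult[OF A(1) B(1)] B(2) by simp
  then show "B \<in> SL n" using A B by (simp add: SL_def)
qed

lemma mat_inverse_eqI:
  fixes A B :: "'a::field mat"
  assumes "A \<in> SL n" "B \<in> carrier_mat n n" "A * B = 1\<^sub>m n"
  shows "the (mat_inverse A) = B"
proof -
  let ?C = "the (mat_inverse A)"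
  have A: "A \<in> carrier_mat n n" using assms by (auto simp: SL_def)
  note C = SL_mat_inverse[OF assms(1)]
  have "?C = ?C * (A * B)" using C assms by simp
  also have "\<dots> = (?C * A) * B" using A C(1) assms(2) by (simp add: assoc_mult_mat)
  also have "\<dots> = B" using C assms by simp
  finally show ?thesis .
qed

lemma SL_mult: "A \<in> SL n \<Longrightarrow> B \<in> SL n \<Longrightarrow> A * B \<in> SL n"
  by (auto simp: SL_def det_mult)

lemma mat_inverse_mult:
  assumes "A \<in> SL n" "B \<in> SL n"
  shows "the (mat_inverse (A * B)) = the (mat_inverse B) * the (mat_inverse A)"
proof (rule mat_inverse_eqI)
  let ?A = "the (mat_inverse A)" and ?B = "the (mat_inverse B)"
  have AB: "A \<in> carrier_mat n n" "B \<in> carrier_mat n n" using assms by (auto simp: SL_def)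
  note a = SL_mat_inverse[OF assms(1)] and b = SL_mat_inverse[OF assms(2)]
  show "?B * ?A \<in> carrier_mat n n" using a(1) b(1) by simp
  have "(A * B) * (?B * ?A) = A * ((B * ?B) * ?A)"
    using AB a(1) b(1) by (simp add: assoc_mult_mat[of _ n n _ n _ n])
  also have "\<dots> = 1\<^sub>m n" using AB a b by simp
  finally show "(A * B) * (?B * ?A) = 1\<^sub>m n" .
qed (use assms SL_mult in auto)

lemma conj_action_outside: "i \<notin> {1..N+1} \<Longrightarrow> conj_action N A F i = 0"
  by (auto simp: conj_action_def)

lemma form_tuples_vars:
  "F \<in> form_tuples N d \<Longrightarrow> mpoly_vars (F i) \<subseteq> {1..N+1}"
  by (cases "i \<in> {1..N+1}") (auto simp: form_tuples_def)

lemma index_mult_mat_shifted: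
  assumes "A \<in> carrier_mat (N+1) (N+1)" "B \<in> carrier_mat (N+1) (N+1)" "i \<in> {1..N+1}" "j \<in> {1..N+1}"
  shows "(A * B) $$ (i - 1, j - 1) = (\<Sum>k\<in>{1..N+1}. A $$ (i - 1, k - 1) * B $$ (k - 1, j - 1))"
proof -
  have "(A * B) $$ (i - 1, j - 1) = (\<Sum>k = 0..<N+1. A $$ (i - 1, k) * B $$ (k, j - 1))"
    using assms by (auto simp: scalar_prod_def)
  also have "\<dots> = (\<Sum>k\<in>{1..N+1}. A $$ (i - 1, k - 1) * B $$ (k - 1, j - 1))"
    by (rule sum.reindex_bij_witness[of _ "\<lambda>k. k - 1" Suc]) auto
  finally show ?thesis .
qed

text \<open>Substitution composes in the order that makes conjugation a left action: the form of the
  inverse of \<open>B\<close>, followed by substitution of the inverse of \<open>A\<close>, belongs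
  to the inverse of \<open>A * B\<close>.\<close>

lemma linear_form_mult:
  fixes A B :: "'a::field mat"
  assumes "A \<in> carrier_mat (N+1) (N+1)" "B \<in> carrier_mat (N+1) (N+1)" "i \<in> {1..N+1}"
  shows "mpoly_eval mconst (linear_form N B) (linear_form N A i) = linear_form N (A * B) i"
proof -
  interpret e: comm_ring_hom "mpoly_eval mconst (linear_form N B)"
    by (rule mconst.comm_ring_hom_mpoly_eval)
  have "mpoly_eval mconst (linear_form N B) (linear_form N A i) =
      (\<Sum>k\<in>{1..N+1}. mconst (A $$ (i - 1, k - 1)) * linear_form N B k)"
    unfolding linear_form_def[of N A i]
    by (simp only: e.hom_sum e.hom_mult mconst.mpoly_eval_mconst mconst.mpoly_eval_mvar)
  also have "\<dots> = (\<Sum>k\<in>{1..N+1}. \<Sum>j\<in>{1..N+1}.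
      mconst (A $$ (i - 1, k - 1) * B $$ (k - 1, j - 1)) * mvar j)"
    by (simp only: linear_form_def sum_distrib_left mconst.hom_mult mult.assoc)
  also have "\<dots> = (\<Sum>j\<in>{1..N+1}. \<Sum>k\<in>{1..N+1}.
      mconst (A $$ (i - 1, k - 1) * B $$ (k - 1, j - 1)) * mvar j)"
    by (rule sum.swap)
  also have "\<dots> = linear_form N (A * B) i"
    unfolding linear_form_def
    by (intro sum.cong refl)
       (simp only: index_mult_mat_shifted[OF assms] mconst.hom_sum sum_distrib_right)
  finally show ?thesis .
qed

lemma conj_action_mult:
  fixes A B :: "'a::field mat"
  assumes "A \<in> SL (N+1)" "B \<in> SL (N+1)" "F \<in> form_tuples N d"
  shows "conj_action N A (conj_action N B F) = conj_action N (A * B) F"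
proof
  fix i
  let ?I = "{1..N+1}"
  let ?A = "the (mat_inverse A)" and ?B = "the (mat_inverse B)"
  have AB: "A \<in> carrier_mat (N+1) (N+1)" "B \<in> carrier_mat (N+1) (N+1)"
    using assms by (auto simp: SL_def)
  note a = SL_mat_inverse[OF assms(1)] and b = SL_mat_inverse[OF assms(2)]
  interpret e: comm_ring_hom "mpoly_eval mconst (linear_form N ?A)"
    by (rule mconst.comm_ring_hom_mpoly_eval)
  \<comment> \<open>\<open>linear_form_mult\<close> speaks only of the indices 1 to
    \<open>N + 1\<close>, so the variables of \<open>F j\<close> have to lie in that range.\<close>
  have subst: "mpoly_eval mconst (linear_form N ?A) (mpoly_eval mconst (linear_form N ?B) (F j)) =
      mpoly_eval mconst (linear_form N (the (mat_inverse (A * B)))) (F j)" for j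
    unfolding mconst.mpoly_eval_mpoly_eval mat_inverse_mult[OF assms(1,2)]
    by (rule mpoly_eval_cong, rule linear_form_mult[OF b(1) a(1)])
       (use form_tuples_vars[OF assms(3)] in blast)
  show "conj_action N A (conj_action N B F) i = conj_action N (A * B) F i"
  proof (cases "i \<in> ?I")
    case True
    have "conj_action N A (conj_action N B F) i =
        (\<Sum>k\<in>?I. mconst (A $$ (i - 1, k - 1)) * (\<Sum>j\<in>?I. mconst (B $$ (k - 1, j - 1)) *
          mpoly_eval mconst (linear_form N (the (mat_inverse (A * B)))) (F j)))"
      unfolding conj_action_def if_P[OF True]
      by (intro sum.cong refl)
         (simp only: if_True e.hom_sum e.hom_mult mconst.mpoly_eval_mconst subst)
    also have "\<dots> = (\<Sum>k\<in>?I. \<Sum>j\<in>?I. mconst (A $$ (i - 1, k - 1) * B $$ (k - 1, j - 1)) *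
          mpoly_eval mconst (linear_form N (the (mat_inverse (A * B)))) (F j))"
      by (simp only: sum_distrib_left mconst.hom_mult mult.assoc)
    also have "\<dots> = (\<Sum>j\<in>?I. \<Sum>k\<in>?I. mconst (A $$ (i - 1, k - 1) * B $$ (k - 1, j - 1)) *
          mpoly_eval mconst (linear_form N (the (mat_inverse (A * B)))) (F j))"
      by (rule sum.swap)
    also have "\<dots> = (\<Sum>j\<in>?I. mconst ((A * B) $$ (i - 1, j - 1)) *
          mpoly_eval mconst (linear_form N (the (mat_inverse (A * B)))) (F j))"
      by (intro sum.cong refl)
         (simp only: index_mult_mat_shifted[OF AB True] mconst.hom_sum sum_distrib_right)
    also have "\<dots> = conj_action N (A * B) F i"
      using True by (simp only: conj_action_def if_True)
    finally show ?thesis .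
  qed (simp only: conj_action_outside not_False_eq_True)
qed

lemma conj_action_scale:
  fixes A :: "'a::field mat"
  shows "conj_action N A (\<lambda>i. mconst c * F i) = (\<lambda>i. mconst c * conj_action N A F i)"
proof
  fix i
  interpret e: comm_ring_hom "mpoly_eval mconst (linear_form N (the (mat_inverse A)))"
    by (rule mconst.comm_ring_hom_mpoly_eval)
  show "conj_action N A (\<lambda>i. mconst c * F i) i = mconst c * conj_action N A F i"
  proof (cases "i \<in> {1..N+1}")
    case True
    show ?thesis
      unfolding conj_action_def if_P[OF True] sum_distrib_left
      by (intro sum.cong refl) (simp only: e.hom_mult mconst.mpoly_eval_mconst mult.left_commute)
  qed (simp only: conj_action_outside mult_zero_right not_False_eq_True)
qed

lemma proj_action_line:
  fixes A :: "'a::field mat"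
  shows "proj_action N A (line F) = line (conj_action N A F)"
  unfolding proj_action_def line_def by (force simp: conj_action_scale)

lemma proj_action_mult:
  fixes A B :: "'a::field mat"
  assumes "A \<in> SL (N+1)" "B \<in> SL (N+1)" "F \<in> form_tuples N d"
  shows "proj_action N (A * B) (line F) = proj_action N A (proj_action N B (line F))"
  by (simp add: proj_action_line conj_action_mult[OF assms])

lemma line_self: "F \<in> line F"
  unfolding line_def by (auto intro!: exI[of _ 1])

section \<open>One-parameter subgroups\<close>

definition one_ps :: "nat \<Rightarrow> (nat \<Rightarrow> int) \<Rightarrow> 'a::field \<Rightarrow> 'a mat" where
  "one_ps N a t = mat (N+1) (N+1) (\<lambda>(i, j). if i = j then t powi a (i + 1) else 0)"

definition mon_weight :: "(nat \<Rightarrow> int) \<Rightarrow> (nat \<Rightarrow>\<^sub>0 nat) \<Rightarrow> int" where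
  "mon_weight a m = (\<Sum>v\<in>Poly_Mapping.keys m. int (Poly_Mapping.lookup m v) * a v)"

lemma prod_power_int:
  fixes t :: "'a::field"
  assumes "t \<noteq> 0"
  shows "(\<Prod>i\<in>S. t powi f i) = t powi (\<Sum>i\<in>S. f i)"
  by (induction S rule: infinite_finite_induct) (simp_all add: power_int_add assms)

lemma one_ps_carrier: "one_ps N a t \<in> carrier_mat (N+1) (N+1)"
  by (simp add: one_ps_def)

lemma index_one_ps:
  assumes "i \<in> {1..N+1}" "j \<in> {1..N+1}"
  shows "one_ps N a t $$ (i - 1, j - 1) = (if i = j then t powi a i else 0)"
  using assms by (auto simp: one_ps_def)

lemma one_ps_SL:
  fixes t :: "'a::field"
  assumes "t \<noteq> 0" "(\<Sum>i\<in>{1..N+1}. a i) = 0"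
  shows "one_ps N a t \<in> SL (N+1)"
proof -
  have "det (one_ps N a t) = prod_list (diag_mat (one_ps N a t))"
    by (rule det_upper_triangular[OF _ one_ps_carrier]) (auto simp: one_ps_def upper_triangular_def)
  also have "\<dots> = (\<Prod>i = 0..<N+1. t powi a (i + 1))"
    by (simp add: prod_list_diag_prod) (simp add: one_ps_def)
  also have "\<dots> = t powi (\<Sum>i = 0..<N+1. a (i + 1))"
    using assms(1) by (rule prod_power_int)
  also have "(\<Sum>i = 0..<N+1. a (i + 1)) = (\<Sum>i\<in>{1..N+1}. a i)"
    by (rule sum.reindex_bij_witness[of _ "\<lambda>k. k - 1" Suc]) auto
  finally show ?thesis using assms(2) one_ps_carrier[of N a t] by (simp add: SL_def)
qed

lemma one_ps_inverse:
  fixes t :: "'a::field"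
  assumes "t \<noteq> 0" "(\<Sum>i\<in>{1..N+1}. a i) = 0"
  shows "the (mat_inverse (one_ps N a t)) = one_ps N (\<lambda>i. - a i) t"
proof (rule mat_inverse_eqI[OF one_ps_SL[OF assms] one_ps_carrier])
  show "one_ps N a t * one_ps N (\<lambda>i. - a i) t = 1\<^sub>m (N + 1)"
  proof (rule eq_matI)
    fix i j assume "i < dim_row (1\<^sub>m (N+1) :: 'a mat)" "j < dim_col (1\<^sub>m (N+1) :: 'a mat)"
    then have ij: "i + 1 \<in> {1..N+1}" "j + 1 \<in> {1..N+1}" by auto
    have "(one_ps N a t * one_ps N (\<lambda>i. - a i) t) $$ (i, j) =
       (\<Sum>k\<in>{1..N+1}. one_ps N a t $$ (i, k - 1) * one_ps N (\<lambda>i. - a i) t $$ (k - 1, j))"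
      using index_mult_mat_shifted[OF one_ps_carrier one_ps_carrier ij] by simp
    also have "\<dots> = (\<Sum>k\<in>{1..N+1}. if k = i + 1 then
        t powi a k * (if i = j then t powi - a k else 0) else 0)"
    proof (rule sum.cong[OF refl])
      fix k assume k: "k \<in> {1..N+1}"
      show "one_ps N a t $$ (i, k - 1) * one_ps N (\<lambda>i. - a i) t $$ (k - 1, j) =
         (if k = i + 1 then t powi a k * (if i = j then t powi - a k else 0) else 0)"
        using index_one_ps[OF ij(1) k, of a t] index_one_ps[OF k ij(2), of "\<lambda>i. - a i" t] by auto
    qed
    also have "\<dots> = (if i = j then 1 else 0)"
      using ij assms(1) by (simp add: power_int_minus)
    finally show "(one_ps N a t * one_ps N (\<lambda>i. - a i) t) $$ (i, j) = 1\<^sub>m (N + 1) $$ (i, j)"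
      using ij by auto
  qed (auto simp: one_ps_def)
qed

text \<open>The left factor of the conjugation contributes \<open>a i\<close>, the substitution of
  the inverse diagonal matrix contributes \<open>- mon_weight a m\<close>. So the coefficients are
  eigencoordinates, and the weight of \<open>m\<close> in coordinate \<open>i\<close> is
  \<open>a i - mon_weight a m\<close>.\<close>

lemma lookup_conj_action_one_ps:
  fixes t :: "'a::field"
  assumes "t \<noteq> 0" "(\<Sum>i\<in>{1..N+1}. a i) = 0" "F \<in> form_tuples N d" "i \<in> {1..N+1}"
  shows "Poly_Mapping.lookup (conj_action N (one_ps N a t) F i) m =
     t powi (a i - mon_weight a m) * Poly_Mapping.lookup (F i) m"
proof -
  let ?c = "\<lambda>w. t powi - a w"
  have lin: "linear_form N (one_ps N (\<lambda>i. - a i) t) j = mconst (?c j) * mvar j"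
    if "j \<in> {1..N+1}" for j
  proof -
    have "linear_form N (one_ps N (\<lambda>i. - a i) t) j =
        (\<Sum>k\<in>{1..N+1}. if k = j then mconst (?c j) * mvar j else 0)"
      unfolding linear_form_def
      by (intro sum.cong refl) (subst index_one_ps[OF that], auto)
    then show ?thesis using that by simp
  qed
  have subst: "mpoly_eval mconst (linear_form N (the (mat_inverse (one_ps N a t)))) (F j) =
     mpoly_eval mconst (\<lambda>w. mconst (?c w) * mvar w) (F j)" for j
    unfolding one_ps_inverse[OF assms(1,2)]
    by (rule mpoly_eval_cong, rule lin) (use form_tuples_vars[OF assms(3)] in blast)
  have mon: "mon_eval ?c m = t powi - mon_weight a m"
  proof -
    have "mon_eval ?c m = (\<Prod>v\<in>Poly_Mapping.keys m. t powi (int (Poly_Mapping.lookup m v) * - a v))"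
      unfolding mon_eval_def by (simp only: mult.commute[of "int _"] power_int_mult power_int_of_nat)
    then show ?thesis
      by (simp add: prod_power_int assms(1) mon_weight_def sum_negf)
  qed
  have "conj_action N (one_ps N a t) F i =
     (\<Sum>j\<in>{1..N+1}. if j = i then mconst (t powi a i) *
          mpoly_eval mconst (\<lambda>w. mconst (?c w) * mvar w) (F i) else 0)"
    unfolding conj_action_def subst if_P[OF assms(4)]
    by (intro sum.cong refl) (subst index_one_ps[OF assms(4)], auto)
  also have "\<dots> = mconst (t powi a i) * mpoly_eval mconst (\<lambda>w. mconst (?c w) * mvar w) (F i)"
    using assms(4) by simp
  finally have "Poly_Mapping.lookup (conj_action N (one_ps N a t) F i) m =
      t powi a i * (Poly_Mapping.lookup (F i) m * t powi - mon_weight a m)"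
    by (simp only: lookup_mconst_mult lookup_diag_subst mon)
  then show ?thesis
    by (simp add: power_int_diff power_int_minus assms(1) field_simps)
qed

lemma conj_action_one:
  assumes "F \<in> form_tuples N d"
  shows "conj_action N (1\<^sub>m (N+1)) F = (F :: 'a::field tuple)"
proof
  fix i
  \<comment> \<open>The identity belongs to the subgroup with all weights zero, so the coefficient
    formula already covers it.\<close>
  have one: "1\<^sub>m (N+1) = one_ps N (\<lambda>_. 0) (1::'a)"
    by (rule eq_matI) (auto simp: one_ps_def)
  show "conj_action N (1\<^sub>m (N+1)) F i = F i"
  proof (cases "i \<in> {1..N+1}")
    case True
    then show ?thesis unfolding one
      by (intro poly_mapping_eqI) (subst lookup_conj_action_one_ps[OF _ _ assms], auto)
  next
    case False
    then show ?thesis using assms by (subst conj_action_outside) (auto simp: form_tuples_def)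
  qed
qed

section \<open>Degeneration along a one-parameter subgroup\<close>

text \<open>When no weight of \<open>F\<close> is negative, this is the limit of the translates of
  \<open>F\<close> as the parameter tends to 0. The sum over \<open>keys\<close> gives finite
  support by construction.\<close>

definition weight_zero_part :: "(nat \<Rightarrow> int) \<Rightarrow> 'a::field tuple \<Rightarrow> 'a tuple" where
  "weight_zero_part a F i = (\<Sum>m\<in>Poly_Mapping.keys (F i).
     Poly_Mapping.single m (if a i = mon_weight a m then Poly_Mapping.lookup (F i) m else 0))"

lemma lookup_weight_zero_part:
  "Poly_Mapping.lookup (weight_zero_part a F i) m =
     (if a i = mon_weight a m then Poly_Mapping.lookup (F i) m else 0)"
proof -
  have "Poly_Mapping.lookup (weight_zero_part a F i) m = (\<Sum>k\<in>Poly_Mapping.keys (F i).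
      if k = m then (if a i = mon_weight a m then Poly_Mapping.lookup (F i) m else 0) else 0)"
    unfolding weight_zero_part_def lookup_sum
    by (intro sum.cong refl) (auto simp: lookup_single when_def)
  then show ?thesis by (auto simp: in_keys_iff)
qed

lemma weight_zero_part_form_tuples:
  assumes "F \<in> form_tuples N d"
  shows "weight_zero_part a F \<in> form_tuples N d"
proof -
  have "Poly_Mapping.keys (weight_zero_part a F i) \<subseteq> Poly_Mapping.keys (F i)" for i
    by (auto simp: in_keys_iff lookup_weight_zero_part split: if_splits)
  moreover have "weight_zero_part a F i = 0" if "F i = 0" for i
    using that by (simp add: weight_zero_part_def)
  ultimately show ?thesis
    using assms unfolding form_tuples_def homogeneous_def mpoly_vars_def by blast
qed

lemma conj_action_weight_zero_part:
  fixes t :: "'a::field"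
  assumes "t \<noteq> 0" "(\<Sum>i\<in>{1..N+1}. a i) = 0" "F \<in> form_tuples N d"
  shows "conj_action N (one_ps N a t) (weight_zero_part a F) = weight_zero_part a F"
proof
  fix i
  note F0 = weight_zero_part_form_tuples[OF assms(3), of a]
  show "conj_action N (one_ps N a t) (weight_zero_part a F) i = weight_zero_part a F i"
  proof (cases "i \<in> {1..N+1}")
    case True
    then show ?thesis
      by (intro poly_mapping_eqI)
         (auto simp: lookup_conj_action_one_ps[OF assms(1,2) F0] lookup_weight_zero_part)
  next
    case False
    then show ?thesis using F0 by (subst conj_action_outside) (auto simp: form_tuples_def)
  qed
qed

text \<open>Along the one-parameter subgroup, a coordinate polynomial is a polynomial in \<open>t\<close>,
  whose value at \<open>t = 0\<close> is the value at the weight zero part.\<close>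

lemma value_at_weight_zero_part:
  fixes F :: "'a::field_char_0 tuple"
  assumes sum0: "(\<Sum>i\<in>{1..N+1}. a i) = 0" and F: "F \<in> form_tuples N d"
    and nonneg: "\<And>i m. i \<in> {1..N+1} \<Longrightarrow> m \<in> Poly_Mapping.keys (F i) \<Longrightarrow> mon_weight a m \<le> a i"
    and const: "\<And>t. t \<noteq> 0 \<Longrightarrow> value_at J (conj_action N (one_ps N a t) F) = c"
  shows "value_at J (weight_zero_part a F) = c"
proof -
  \<comment> \<open>Truncation by \<open>nat\<close> is harmless: where a coefficient is nonzero the
    weight is nonnegative, and elsewhere the power of \<open>t\<close> is multiplied by 0.\<close>
  define w where "w = (\<lambda>i m. nat (a i - mon_weight a m))"
  \<comment> \<open>The restriction of \<open>J\<close> to the curve of translates, as a polynomial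
    in the parameter; it makes sense at \<open>t = 0\<close>, where the subgroup itself is
    undefined.\<close>
  define q where "q = mpoly_eval (\<lambda>c. [:c:]) (\<lambda>(i, m). monom (Poly_Mapping.lookup (F i) m) (w i m)) J"
  have poly_q: "poly q t = mpoly_eval id (\<lambda>(i, m). Poly_Mapping.lookup (F i) m * t ^ w i m) J" for t
    unfolding q_def mpoly_eval_def
    by (simp add: poly_sum poly_prod poly_monom split_def)
  have F_out: "F i = 0" if "i \<notin> {1..N+1}" for i
    using that F by (simp add: form_tuples_def)
  have "poly q t = c" if t: "t \<noteq> 0" for t
  proof -
    have "Poly_Mapping.lookup (F i) m * t ^ w i m =
        Poly_Mapping.lookup (conj_action N (one_ps N a t) F i) m" for i m
    proof (cases "i \<in> {1..N+1} \<and> m \<in> Poly_Mapping.keys (F i)")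
      case True
      then have "t ^ w i m = t powi (a i - mon_weight a m)"
        using nonneg[of i m] by (simp add: w_def power_int_def)
      then show ?thesis using True by (simp add: lookup_conj_action_one_ps[OF t sum0 F])
    next
      case False
      then have "Poly_Mapping.lookup (F i) m = 0" using F_out[of i] by (auto simp: in_keys_iff)
      moreover have "Poly_Mapping.lookup (conj_action N (one_ps N a t) F i) m = 0"
      proof (cases "i \<in> {1..N+1}")
        case True
        then show ?thesis
          unfolding lookup_conj_action_one_ps[OF t sum0 F True] by (simp add: calculation)
      next
        case False
        then show ?thesis unfolding conj_action_outside[OF False] by simp
      qed
      ultimately show ?thesis by simp
    qed
    then show ?thesis using const[OF t] by (simp add: poly_q value_at_def)
  qed
  \<comment> \<open>Characteristic 0 makes the field infinite, so \<open>q\<close> is the constant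
    \<open>c\<close>, also at 0.\<close>
  then have "UNIV - {0} \<subseteq> {t. poly (q - [:c:]) t = 0}" by auto
  moreover have "infinite (UNIV - {0 :: 'a})" by (simp add: infinite_UNIV_char_0)
  ultimately have "q - [:c:] = 0" using poly_roots_finite finite_subset by blast
  then have "poly q 0 = c" by simp
  \<comment> \<open>The convention \<open>0 ^ 0 = 1\<close> is what singles out the coefficients of
    weight zero.\<close>
  moreover have "Poly_Mapping.lookup (F i) m * 0 ^ w i m =
      Poly_Mapping.lookup (weight_zero_part a F i) m" for i m
  proof (cases "i \<in> {1..N+1} \<and> m \<in> Poly_Mapping.keys (F i)")
    case True
    then show ?thesis
      using nonneg[of i m] by (auto simp: w_def lookup_weight_zero_part power_0_left)
  next
    case False
    then show ?thesis
      by (cases "i \<in> {1..N+1}") (auto simp: F_out lookup_weight_zero_part in_keys_iff)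
  qed
  ultimately show ?thesis by (simp add: poly_q value_at_def)
qed

lemma value_at_scale:
  fixes F :: "'a::field tuple"
  assumes "homogeneous e J"
  shows "value_at J (\<lambda>i. mconst c * F i) = c ^ e * value_at J F"
proof -
  define x where "x = (\<lambda>(i, m). Poly_Mapping.lookup (F i) m)"
  have scale: "mon_eval (\<lambda>v. c * x v) m = c ^ mon_degree m * mon_eval x m" for m
    by (simp add: mon_eval_def mon_degree_def power_mult_distrib prod.distrib power_sum)
  have "value_at J (\<lambda>i. mconst c * F i) = mpoly_eval id (\<lambda>v. c * x v) J"
    by (simp add: value_at_def x_def split_def)
  also have "\<dots> = c ^ e * mpoly_eval id x J"
    using assms unfolding mpoly_eval_alt sum_distrib_left
    by (intro sum.cong) (auto simp: scale homogeneous_def)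
  finally show ?thesis by (simp add: value_at_def x_def)
qed

text \<open>A non-constant form has positive degree. This is how non-constancy in the definition of
  semistability enters the instability argument.\<close>

lemma value_at_zero:
  assumes "homogeneous e J" "\<nexists>c. J = mconst c"
  shows "value_at J (\<lambda>_. 0 :: (nat, 'a::field) mpoly) = 0"
proof -
  have "e \<noteq> 0"
  proof
    assume "e = 0"
    with assms(1) have "J = mconst (Poly_Mapping.lookup J 0)"
      by (simp add: homogeneous_0_imp_mconst[symmetric])
    with assms(2) show False by blast
  qed
  then show ?thesis using value_at_scale[OF assms(1), of 0 "\<lambda>_. 0"] by (simp add: power_0_left)
qed

lemma vanishes_at_line:
  assumes "homogeneous e J" "value_at J F = 0"
  shows "vanishes_at J (line F)"
  unfolding vanishes_at_def
proof
  fix G assume "G \<in> line F"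
  then obtain c where "G = (\<lambda>i. mconst c * F i)" unfolding line_def by blast
  then show "value_at J G = 0" using value_at_scale[OF assms(1), of c F] assms(2) by simp
qed

section \<open>Numerical criteria\<close>

lemma unstable_if_positive_weights:
  fixes F :: "'a::field_char_0 tuple"
  assumes sum0: "(\<Sum>i\<in>{1..N+1}. a i) = 0"
    and F: "F \<in> form_tuples N d" "F \<noteq> (\<lambda>_. 0)"
    and pos: "\<And>i m. i \<in> {1..N+1} \<Longrightarrow> m \<in> Poly_Mapping.keys (F i) \<Longrightarrow> mon_weight a m < a i"
  shows "line F \<in> unstable_locus N d"
proof -
  have "vanishes_at J (line F)"
    if J: "homogeneous e J" "\<nexists>c. J = mconst c" and inv: "SL_invariant N d J" for J e
  proof (rule vanishes_at_line[OF J(1)])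
    have F_out: "F i = 0" if "i \<notin> {1..N+1}" for i
      using that F(1) by (simp add: form_tuples_def)
    have "weight_zero_part a F i = 0" for i
    proof (rule poly_mapping_eqI)
      fix m
      show "Poly_Mapping.lookup (weight_zero_part a F i) m = Poly_Mapping.lookup 0 m"
      proof (cases "i \<in> {1..N+1} \<and> m \<in> Poly_Mapping.keys (F i)")
        case True
        then have "mon_weight a m < a i" by (intro pos) auto
        then show ?thesis by (simp add: lookup_weight_zero_part)
      next
        case False
        then have "Poly_Mapping.lookup (F i) m = 0" using F_out[of i] by (auto simp: in_keys_iff)
        then show ?thesis by (simp add: lookup_weight_zero_part)
      qed
    qed
    then have "weight_zero_part a F = (\<lambda>_. 0)" by (rule ext)
    moreover have "value_at J (weight_zero_part a F) = value_at J F"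
    proof (rule value_at_weight_zero_part[OF sum0 F(1)])
      show "mon_weight a m \<le> a i" if "i \<in> {1..N+1}" "m \<in> Poly_Mapping.keys (F i)" for i m
        using pos[OF that] by simp
      show "value_at J (conj_action N (one_ps N a t) F) = value_at J F" if "t \<noteq> 0" for t
        using inv one_ps_SL[OF that sum0] F(1) by (auto simp: SL_invariant_def)
    qed
    ultimately show "value_at J F = 0" using value_at_zero[OF J] by simp
  qed
  then have "line F \<notin> semistable_locus N d" unfolding semistable_locus_def by blast
  moreover have "line F \<in> proj_space N d" using F unfolding proj_space_def by blast
  ultimately show ?thesis by (simp add: unstable_locus_def)
qed

text \<open>If the point were stable, its limit under the one-parameter subgroup would lie in its orbit,
  although the limit is fixed by the whole one-parameter subgroup.\<close>

lemma not_stable_if_nonneg_weights: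
  fixes F :: "'a::field_char_0 tuple"
  assumes sum0: "(\<Sum>i\<in>{1..N+1}. a i) = 0" and j: "j \<in> {1..N+1}" "a j = 1"
    and F: "F \<in> form_tuples N d"
    and nonneg: "\<And>i m. i \<in> {1..N+1} \<Longrightarrow> m \<in> Poly_Mapping.keys (F i) \<Longrightarrow> mon_weight a m \<le> a i"
  shows "line F \<notin> stable_locus N d"
proof
  assume stable: "line F \<in> stable_locus N d"
  then have fin: "finite (SL_stabilizer N (line F))" by (simp add: stable_locus_def)
  obtain Z where "zariski_closed N d Z" and Z: "SL_orbit N (line F) = Z \<inter> semistable_locus N d"
    using stable by (auto simp: stable_locus_def)
  then obtain S where S: "S \<subseteq> {J \<in> coord_polys N d. \<exists>e. homogeneous e J}"
    and Z_eq: "Z = {p \<in> proj_space N d. \<forall>J\<in>S. vanishes_at J p}"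
    by (auto simp: zariski_closed_def)
  obtain J e where J: "J \<in> coord_polys N d" "homogeneous e J" "\<nexists>c. J = mconst c"
      "SL_invariant N d J" "\<not> vanishes_at J (line F)"
    using stable by (auto simp: stable_locus_def semistable_locus_def)
  define F0 where "F0 = weight_zero_part a F"
  have F0: "F0 \<in> form_tuples N d" unfolding F0_def by (rule weight_zero_part_form_tuples[OF F])
  \<comment> \<open>The invariant that witnesses semistability of \<open>F\<close> is constant along
    the curve, so it witnesses semistability of the limit \<open>F0\<close> too.\<close>
  have "value_at J F0 = value_at J F" unfolding F0_def
  proof (rule value_at_weight_zero_part[OF sum0 F nonneg])
    show "value_at J (conj_action N (one_ps N a t) F) = value_at J F" if "t \<noteq> 0" for t
      using J(4) one_ps_SL[OF that sum0] F by (auto simp: SL_invariant_def)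
  qed
  moreover have "value_at J F \<noteq> 0" using J(2,5) vanishes_at_line by blast
  ultimately have J_F0: "value_at J F0 \<noteq> 0" by simp
  have "F0 \<noteq> (\<lambda>_. 0)" using J_F0 value_at_zero[OF J(2,3)] by auto
  then have proj: "line F0 \<in> proj_space N d" using F0 by (auto simp: proj_space_def)
  have "\<not> vanishes_at J (line F0)" using J_F0 line_self by (auto simp: vanishes_at_def)
  with J proj have semi: "line F0 \<in> semistable_locus N d" by (auto simp: semistable_locus_def)
  \<comment> \<open>The equations of \<open>Z\<close> hold on the orbit, hence along the curve,
    hence at its limit. Together with semistability of \<open>F0\<close> this puts the limit into
    the orbit.\<close>
  have "vanishes_at J' (line F0)" if J': "J' \<in> S" for J'
  proof -
    obtain e' where e': "homogeneous e' J'" using J' S by auto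
    have "value_at J' F0 = 0" unfolding F0_def
    proof (rule value_at_weight_zero_part[OF sum0 F nonneg])
      fix t :: 'a assume t: "t \<noteq> 0"
      have "proj_action N (one_ps N a t) (line F) \<in> SL_orbit N (line F)"
        using one_ps_SL[OF t sum0] by (auto simp: SL_orbit_def)
      then have "vanishes_at J' (proj_action N (one_ps N a t) (line F))"
        using Z Z_eq J' by auto
      then show "value_at J' (conj_action N (one_ps N a t) F) = 0"
        using line_self by (auto simp: proj_action_line vanishes_at_def)
    qed
    then show ?thesis by (rule vanishes_at_line[OF e'])
  qed
  with proj semi have "line F0 \<in> SL_orbit N (line F)" using Z Z_eq by auto
  then obtain A where A: "A \<in> SL (N+1)" "line F0 = proj_action N A (line F)"
    by (auto simp: SL_orbit_def)
  define B where "B = the (mat_inverse A)"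
  have B: "B \<in> SL (N+1)" "A * B = 1\<^sub>m (N+1)" "B * A = 1\<^sub>m (N+1)"
    using SL_mat_inverse[OF A(1)] by (auto simp: B_def)
  have carr: "A \<in> carrier_mat (N+1) (N+1)" "B \<in> carrier_mat (N+1) (N+1)"
    using A(1) B(1) by (auto simp: SL_def)
  \<comment> \<open>The subgroup fixes \<open>F0\<close>, and \<open>A\<close> carries the line of
    \<open>F\<close> to that of \<open>F0\<close>; conjugating the subgroup by \<open>A\<close>
    moves it into the stabilizer of the line of \<open>F\<close>.\<close>
  define M where "M = (\<lambda>t. B * (one_ps N a t * A))"
  have "M t \<in> SL_stabilizer N (line F)" if t: "t \<noteq> 0" for t
  proof -
    note D = one_ps_SL[OF t sum0]
    have "proj_action N (M t) (line F) = proj_action N B (proj_action N (one_ps N a t) (line F0))"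
      unfolding M_def A(2) proj_action_mult[OF B(1) SL_mult[OF D A(1)] F] proj_action_mult[OF D A(1) F] ..
    also have "\<dots> = proj_action N B (line F0)"
      by (simp add: proj_action_line F0_def conj_action_weight_zero_part[OF t sum0 F])
    also have "\<dots> = proj_action N (B * A) (line F)"
      unfolding A(2) proj_action_mult[OF B(1) A(1) F] ..
    also have "\<dots> = line F" unfolding B(3) by (simp only: proj_action_line conj_action_one[OF F])
    finally show ?thesis
      using SL_mult[OF B(1) SL_mult[OF D A(1)]] by (simp add: SL_stabilizer_def M_def)
  qed
  then have "M ` (UNIV - {0}) \<subseteq> SL_stabilizer N (line F)" by auto
  then have "finite (M ` (UNIV - {0}))" using fin finite_subset by blast
  \<comment> \<open>Undoing the conjugation leaves the diagonal matrix, and since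
    \<open>a j = 1\<close> its entry at \<open>j\<close> is \<open>t\<close> itself. The stabilizer
    thus contains a copy of the infinite set of nonzero scalars.\<close>
  moreover have "inj_on M (UNIV - {0})"
  proof (rule inj_on_inverseI[where g = "\<lambda>X. (A * (X * B)) $$ (j - 1, j - 1)"])
    fix t :: 'a assume t: "t \<in> UNIV - {0}"
    have "A * (M t * B) = (A * B) * (one_ps N a t * (A * B))"
      unfolding M_def using carr one_ps_carrier[of N a t] by (simp add: assoc_mult_mat[of _ "N+1" "N+1" _ "N+1" _ "N+1"])
    also have "\<dots> = one_ps N a t" using B(2) one_ps_carrier[of N a t] by simp
    finally show "(A * (M t * B)) $$ (j - 1, j - 1) = t"
      using index_one_ps[OF j(1) j(1), of a t] j(2) by simp
  qed
  ultimately have "finite (UNIV - {0 :: 'a})" by (rule finite_imageD)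
  then show False by (simp add: infinite_UNIV_char_0)
qed

section \<open>Homogenization\<close>

lemma mon_degree_le_total_degree: "m \<in> Poly_Mapping.keys p \<Longrightarrow> mon_degree m \<le> total_degree p"
  by (simp add: total_degree_def)

lemma total_degree_attained:
  assumes "total_degree p \<noteq> 0"
  obtains m where "m \<in> Poly_Mapping.keys p" "mon_degree m = total_degree p"
proof -
  have "total_degree p \<in> insert 0 (mon_degree ` Poly_Mapping.keys p)"
    unfolding total_degree_def by (rule Max_in) auto
  with assms that show ?thesis by auto
qed

lemma keys_homogenize:
  "Poly_Mapping.keys (homogenize d v p) \<subseteq>
     (\<lambda>m. m + Poly_Mapping.single v (d - mon_degree m)) ` Poly_Mapping.keys p"
proof
  fix n assume "n \<in> Poly_Mapping.keys (homogenize d v p)"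
  then have "(\<Sum>m\<in>Poly_Mapping.keys p. Poly_Mapping.lookup (Poly_Mapping.single
      (m + Poly_Mapping.single v (d - mon_degree m)) (Poly_Mapping.lookup p m)) n) \<noteq> 0"
    by (simp add: in_keys_iff homogenize_def lookup_sum)
  then obtain m where "m \<in> Poly_Mapping.keys p" "Poly_Mapping.lookup (Poly_Mapping.single
      (m + Poly_Mapping.single v (d - mon_degree m)) (Poly_Mapping.lookup p m)) n \<noteq> 0"
    by (rule sum.not_neutral_contains_not_neutral)
  then show "n \<in> (\<lambda>m. m + Poly_Mapping.single v (d - mon_degree m)) ` Poly_Mapping.keys p"
    by (auto simp: lookup_single when_def split: if_splits)
qed

lemma homogeneous_homogenize:
  assumes "total_degree p \<le> d"
  shows "homogeneous d (homogenize d v p)"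
  unfolding homogeneous_def
proof
  fix n assume "n \<in> Poly_Mapping.keys (homogenize d v p)"
  then obtain m where m: "m \<in> Poly_Mapping.keys p" "n = m + Poly_Mapping.single v (d - mon_degree m)"
    using keys_homogenize[of d v p] by auto
  then show "mon_degree n = d" using mon_degree_le_total_degree[OF m(1)] assms by simp
qed

lemma mpoly_vars_homogenize: "mpoly_vars (homogenize d v p) \<subseteq> insert v (mpoly_vars p)"
proof
  fix w assume "w \<in> mpoly_vars (homogenize d v p)"
  then obtain n where n: "n \<in> Poly_Mapping.keys (homogenize d v p)" "w \<in> Poly_Mapping.keys n"
    by (auto simp: mpoly_vars_def)
  then obtain m where m: "m \<in> Poly_Mapping.keys p" "n = m + Poly_Mapping.single v (d - mon_degree m)"
    using keys_homogenize[of d v p] by auto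
  with n(2) have "w \<in> Poly_Mapping.keys m \<or> w = v"
    using keys_add[of m "Poly_Mapping.single v (d - mon_degree m)"] by (auto split: if_splits)
  with m(1) show "w \<in> insert v (mpoly_vars p)" by (auto simp: mpoly_vars_def)
qed

text \<open>Since \<open>v\<close> occurs neither in \<open>p\<close> nor in \<open>m\<close>,
  deleting the power of \<open>v\<close> recovers the monomial; hence no two terms of
  \<open>p\<close> merge.\<close>

lemma lookup_homogenize:
  assumes "v \<notin> mpoly_vars p" "v \<notin> Poly_Mapping.keys m"
  shows "Poly_Mapping.lookup (homogenize d v p) (m + Poly_Mapping.single v (d - mon_degree m)) =
    Poly_Mapping.lookup p m"
proof -
  have inj: "n = m" if "n \<in> Poly_Mapping.keys p"
    "n + Poly_Mapping.single v (d - mon_degree n) = m + Poly_Mapping.single v (d - mon_degree m)" for n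
  proof (rule poly_mapping_eqI)
    fix w
    have "v \<notin> Poly_Mapping.keys n" using assms(1) that(1) by (auto simp: mpoly_vars_def)
    then show "Poly_Mapping.lookup n w = Poly_Mapping.lookup m w"
      using arg_cong[OF that(2), of "\<lambda>q. Poly_Mapping.lookup q w"] assms(2)
      by (cases "w = v") (auto simp: lookup_add lookup_single in_keys_iff)
  qed
  have "Poly_Mapping.lookup (homogenize d v p) (m + Poly_Mapping.single v (d - mon_degree m)) =
      (\<Sum>n\<in>Poly_Mapping.keys p. if n = m then Poly_Mapping.lookup p m else 0)"
    unfolding homogenize_def lookup_sum
    by (intro sum.cong refl) (auto simp: lookup_single when_def dest: inj)
  then show ?thesis by (auto simp: in_keys_iff)
qed

section \<open>Weights of monomials\<close>

lemma mon_weight_superset: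
  assumes "finite S" "Poly_Mapping.keys m \<subseteq> S"
  shows "mon_weight a m = (\<Sum>v\<in>S. int (Poly_Mapping.lookup m v) * a v)"
  unfolding mon_weight_def by (rule sum.mono_neutral_left) (use assms in \<open>auto simp: in_keys_iff\<close>)

lemma mon_weight_add [simp]: "mon_weight a (m + n) = mon_weight a m + mon_weight a n"
proof -
  let ?S = "Poly_Mapping.keys m \<union> Poly_Mapping.keys n"
  have "mon_weight a (m + n) = (\<Sum>v\<in>?S. int (Poly_Mapping.lookup (m + n) v) * a v)"
    by (rule mon_weight_superset) (use keys_add[of m n] in auto)
  also have "\<dots> = (\<Sum>v\<in>?S. int (Poly_Mapping.lookup m v) * a v) +
      (\<Sum>v\<in>?S. int (Poly_Mapping.lookup n v) * a v)"
    by (simp add: lookup_add sum.distrib algebra_simps)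
  also have "\<dots> = mon_weight a m + mon_weight a n"
    by (subst (1 2) mon_weight_superset[of ?S]) auto
  finally show ?thesis .
qed

lemma mon_weight_single [simp]: "mon_weight a (Poly_Mapping.single v n) = int n * a v"
  by (simp add: mon_weight_def)

lemma mon_weight_const:
  assumes "\<And>v. v \<in> Poly_Mapping.keys m \<Longrightarrow> a v = c"
  shows "mon_weight a m = int (mon_degree m) * c"
  unfolding mon_weight_def mon_degree_def of_nat_sum sum_distrib_right
  by (rule sum.cong) (simp_all add: assms)

section \<open>Generalized Henon maps\<close>

locale henon =
  fixes N k d :: nat and b :: "nat \<Rightarrow> 'a::field_char_0" and P :: "nat \<Rightarrow> (nat, 'a) mpoly"
  assumes k2: "k \<ge> 2" and kN: "N \<ge> k" and d2: "d \<ge> 2"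
    and b_nonzero: "\<And>j. j \<in> {1..N} \<Longrightarrow> b j \<noteq> 0"
    and P_vars: "\<And>i. i \<in> {k..N} \<Longrightarrow> mpoly_vars (P (i+1)) \<subseteq> {k..i}"
    and P_degree: "Max ((\<lambda>i. total_degree (P (i+1))) ` {k..N}) = d"
begin

abbreviation F where "F \<equiv> henon_tuple N k d b P"

text \<open>The linear part of the map is a cyclic shift of the first \<open>N\<close> variables;
  this merges the three branches of \<open>henon_affine\<close> into one formula.\<close>

definition next_var :: "nat \<Rightarrow> nat" where
  "next_var i = (if i < N then i + 1 else 1)"

lemma next_var_range: "i \<in> {1..N} \<Longrightarrow> next_var i \<in> {1..N}"
  using k2 kN by (auto simp: next_var_def)

lemma henon_affine_eq:
  assumes "i \<in> {1..N}"
  shows "henon_affine N k b P i =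
    mconst (b (next_var i)) * mvar (next_var i) + (if k \<le> i then P (i+1) else 0)"
  using assms kN by (auto simp: henon_affine_def next_var_def)

lemma P_degree_le: "i \<in> {k..N} \<Longrightarrow> total_degree (P (i+1)) \<le> d"
  unfolding P_degree[symmetric] by (rule Max_ge) auto

lemma keys_henon_affine:
  assumes "i \<in> {1..N}" "m \<in> Poly_Mapping.keys (henon_affine N k b P i)"
  shows "m = Poly_Mapping.single (next_var i) 1 \<or>
    k \<le> i \<and> Poly_Mapping.keys m \<subseteq> {k..i} \<and> mon_degree m \<le> d"
proof -
  have "m \<in> Poly_Mapping.keys (mconst (b (next_var i)) * mvar (next_var i)) \<or>
      k \<le> i \<and> m \<in> Poly_Mapping.keys (P (i+1))"
    using assms keys_add[of "mconst (b (next_var i)) * mvar (next_var i)" "if k \<le> i then P (i+1) else 0"]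
    unfolding henon_affine_eq[OF assms(1)] by (auto split: if_splits)
  then show ?thesis
  proof
    assume "m \<in> Poly_Mapping.keys (mconst (b (next_var i)) * mvar (next_var i))"
    then show ?thesis by (simp add: mvar_def mconst_mult_single split: if_splits)
  next
    assume m: "k \<le> i \<and> m \<in> Poly_Mapping.keys (P (i+1))"
    then have i: "i \<in> {k..N}" using assms(1) by simp
    have "Poly_Mapping.keys m \<subseteq> mpoly_vars (P (i+1))" using m by (auto simp: mpoly_vars_def)
    then have "Poly_Mapping.keys m \<subseteq> {k..i}" using P_vars[OF i] by (rule subset_trans)
    moreover have "mon_degree m \<le> d"
      using mon_degree_le_total_degree[of m "P (i+1)"] P_degree_le[OF i] m by simp
    ultimately show ?thesis using m by simp
  qed
qed

text \<open>The case rule for both weight estimates: in the first \<open>N\<close> coordinates only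
  these two kinds of monomials have to be checked.\<close>

lemma keys_F:
  assumes "i \<in> {1..N}" "m \<in> Poly_Mapping.keys (F i)"
  obtains "m = Poly_Mapping.single (next_var i) 1 + Poly_Mapping.single (N+1) (d - 1)"
    | n where "k \<le> i" "Poly_Mapping.keys n \<subseteq> {k..i}" "mon_degree n \<le> d"
        "m = n + Poly_Mapping.single (N+1) (d - mon_degree n)"
proof -
  have "m \<in> Poly_Mapping.keys (homogenize d (N+1) (henon_affine N k b P i))"
    using assms by (simp add: henon_tuple_def)
  then obtain n where n: "n \<in> Poly_Mapping.keys (henon_affine N k b P i)"
      "m = n + Poly_Mapping.single (N+1) (d - mon_degree n)"
    using keys_homogenize[of d "N+1" "henon_affine N k b P i"] by auto
  from keys_henon_affine[OF assms(1) n(1)] that n(2) show ?thesis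
    by (metis mon_degree_single)
qed

lemma F_last: "F (N+1) = Poly_Mapping.single (Poly_Mapping.single (N+1) d) 1"
  by (simp add: henon_tuple_def mvar_power)

lemma henon_affine_vars:
  assumes "i \<in> {1..N}"
  shows "mpoly_vars (henon_affine N k b P i) \<subseteq> {1..N}"
proof
  fix v assume "v \<in> mpoly_vars (henon_affine N k b P i)"
  then obtain m where m: "m \<in> Poly_Mapping.keys (henon_affine N k b P i)" "v \<in> Poly_Mapping.keys m"
    by (auto simp: mpoly_vars_def)
  from keys_henon_affine[OF assms m(1)] show "v \<in> {1..N}"
  proof
    assume "m = Poly_Mapping.single (next_var i) 1"
    then show ?thesis using m(2) next_var_range[OF assms] by simp
  next
    assume "k \<le> i \<and> Poly_Mapping.keys m \<subseteq> {k..i} \<and> mon_degree m \<le> d"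
    then have "v \<in> {k..i}" using m(2) by auto
    then show ?thesis using assms k2 by simp
  qed
qed

lemma henon_affine_degree:
  assumes "i \<in> {1..N}"
  shows "total_degree (henon_affine N k b P i) \<le> d"
proof -
  have "mon_degree m \<le> d" if "m \<in> Poly_Mapping.keys (henon_affine N k b P i)" for m
    using keys_henon_affine[OF assms that] d2 by auto
  then show ?thesis by (simp add: total_degree_def)
qed

lemma F_form_tuples: "F \<in> form_tuples N d"
proof -
  have "homogeneous d (F i) \<and> mpoly_vars (F i) \<subseteq> {1..N+1}" if i: "i \<in> {1..N+1}" for i
  proof (cases "i = N + 1")
    case True
    then show ?thesis unfolding True F_last by (simp add: homogeneous_def mpoly_vars_def)
  next
    case False
    then have i': "i \<in> {1..N}" using i by simp
    have "F i = homogenize d (N+1) (henon_affine N k b P i)"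
      using i' by (simp add: henon_tuple_def)
    then show ?thesis
      using homogeneous_homogenize[OF henon_affine_degree[OF i']]
        mpoly_vars_homogenize[of d "N+1" "henon_affine N k b P i"] henon_affine_vars[OF i']
      by fastforce
  qed
  moreover have "F i = 0" if "i \<notin> {1..N+1}" for i
    using that by (auto simp: henon_tuple_def)
  ultimately show ?thesis unfolding form_tuples_def by blast
qed

lemma F_nonzero: "F \<noteq> (\<lambda>_. 0)"
proof
  assume "F = (\<lambda>_. 0)"
  then have "F (N+1) = 0" by simp
  then have "Poly_Mapping.lookup (F (N+1)) (Poly_Mapping.single (N+1) d) = 0" by simp
  then show False unfolding F_last by simp
qed

lemma lookup_F:
  assumes "i \<in> {1..N}" "Poly_Mapping.keys m \<subseteq> {1..N}"
  shows "Poly_Mapping.lookup (F i) (m + Poly_Mapping.single (N+1) (d - mon_degree m)) =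
    Poly_Mapping.lookup (henon_affine N k b P i) m"
proof -
  have "F i = homogenize d (N+1) (henon_affine N k b P i)"
    using assms(1) by (simp add: henon_tuple_def)
  moreover have "N + 1 \<notin> mpoly_vars (henon_affine N k b P i)" "N + 1 \<notin> Poly_Mapping.keys m"
    using henon_affine_vars[OF assms(1)] assms(2) by auto
  ultimately show ?thesis by (simp only: lookup_homogenize not_False_eq_True)
qed

text \<open>Some \<open>P (i+1)\<close> contains a monomial of degree exactly \<open>d\<close>. It
  acquires no power of \<open>x_(N+1)\<close>, and because \<open>d \<ge> 2\<close> it cannot cancel
  against the linear term.\<close>

lemma not_mvar_dvd_F: "\<exists>i\<in>{1..N}. \<not> mvar (N+1) dvd F i"
proof -
  have "d \<in> (\<lambda>i. total_degree (P (i+1))) ` {k..N}"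
    unfolding P_degree[symmetric] by (rule Max_in) (use kN in auto)
  then obtain i where i: "i \<in> {k..N}" "total_degree (P (i+1)) = d" by auto
  then obtain m where m: "m \<in> Poly_Mapping.keys (P (i+1))" "mon_degree m = d"
    using total_degree_attained[of "P (i+1)"] d2 by auto
  have i1: "i \<in> {1..N}" using i k2 by simp
  have "Poly_Mapping.keys m \<subseteq> mpoly_vars (P (i+1))" using m(1) by (auto simp: mpoly_vars_def)
  also have "\<dots> \<subseteq> {k..i}" by (rule P_vars[OF i(1)])
  also have "\<dots> \<subseteq> {1..N}" using k2 i(1) by auto
  finally have keys_m: "Poly_Mapping.keys m \<subseteq> {1..N}" .
  have "m \<noteq> Poly_Mapping.single (next_var i) 1" using m(2) d2 by auto
  then have "Poly_Mapping.lookup (henon_affine N k b P i) m = Poly_Mapping.lookup (P (i+1)) m"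
    unfolding henon_affine_eq[OF i1] using i(1)
    by (simp add: lookup_add mvar_def lookup_single when_def)
  then have "Poly_Mapping.lookup (F i) m \<noteq> 0"
    using lookup_F[OF i1 keys_m] m by (simp add: in_keys_iff)
  moreover have "Poly_Mapping.lookup m (N+1) = 0"
    using keys_m by (metis Suc_eq_plus1 Suc_n_not_le_n atLeastAtMost_iff in_keys_iff subsetD)
  ultimately have "\<not> mvar (N+1) dvd F i" by (auto simp: mvar_dvd_iff in_keys_iff)
  with i1 show ?thesis by blast
qed

text \<open>A common factor divides \<open>x_(N+1)^d\<close>, so it is a unit or a multiple of
  \<open>x_(N+1)\<close>; in the second case \<open>x_(N+1)\<close> would divide every
  coordinate.\<close>

lemma henon_point_Rat_space: "henon_point N k d b P \<in> Rat_space N d"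
proof -
  have "G dvd 1" if G: "\<forall>i\<in>{1..N+1}. G dvd F i" for G
  proof -
    have "G dvd F (N+1)" using G by auto
    then have "G dvd mvar (N+1) ^ d" by (simp add: henon_tuple_def)
    then have "G dvd 1 \<or> mvar (N+1) dvd G" by (rule dvd_mvar_power_cases)
    moreover have "\<not> mvar (N+1) dvd G"
    proof
      assume *: "mvar (N+1) dvd G"
      obtain i where i: "i \<in> {1..N}" "\<not> mvar (N+1) dvd F i" using not_mvar_dvd_F by auto
      then have "G dvd F i" using G by simp
      with * i(2) show False using dvd_trans by blast
    qed
    ultimately show ?thesis by blast
  qed
  then show ?thesis
    unfolding henon_point_def Rat_space_def using F_form_tuples F_nonzero by blast
qed

lemma henon_point_unstable:
  assumes "d \<ge> 3 \<or> k \<ge> 3"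
  shows "henon_point N k d b P \<in> unstable_locus N d"
proof -
  \<comment> \<open>The linear terms force the first weights to stay below \<open>(d - 1) * s\<close>, while the weights have
    to sum to 0; both are possible because \<open>(d - 1) * (k - 1) \<ge> 2\<close>.\<close>
  define n where "n = int N - int k + 1"
  define \<epsilon> where "\<epsilon> = int k - 1"
  define S where "S = n + int k"
  \<comment> \<open>Forced by the zero sum: the first \<open>k - 1\<close> weights add up to
    \<open>\<epsilon> * (S + n)\<close>, the next \<open>n\<close> to
    \<open>- n * \<epsilon>\<close>.\<close>
  define s where "s = \<epsilon> * S"
  define a where "a = (\<lambda>i. if i < k then S + n else if i \<le> N then - \<epsilon> else - s)"
  have n: "n \<ge> 1" and \<epsilon>: "\<epsilon> \<ge> 1" and S: "S \<ge> 3" using k2 kN by (auto simp: n_def \<epsilon>_def S_def)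
  have s: "s \<ge> \<epsilon>" unfolding s_def using \<epsilon> S by simp
  \<comment> \<open>Among the first \<open>N\<close> weights the largest is at most
    \<open>S + n\<close> and the smallest at least \<open>- \<epsilon>\<close>, a spread of at most
    \<open>2 * S - 1\<close>. The factor \<open>x_(N+1)^(d-1)\<close> of a linear term lowers its
    weight by \<open>(d - 1) * s\<close>, which must exceed this spread.\<close>
  have ds: "(int d - 1) * s \<ge> 2 * S"
  proof -
    have "(int d - 1) * \<epsilon> \<ge> 2"
    proof (cases "d \<ge> 3")
      case True
      then have "2 * 1 \<le> (int d - 1) * \<epsilon>" using \<epsilon> by (intro mult_mono) auto
      then show ?thesis by simp
    next
      case False
      then have "1 * 2 \<le> (int d - 1) * \<epsilon>" using assms d2 by (intro mult_mono) (auto simp: \<epsilon>_def)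
      then show ?thesis by simp
    qed
    then have "2 * S \<le> ((int d - 1) * \<epsilon>) * S" using S by (intro mult_right_mono) auto
    then show ?thesis by (simp add: s_def mult.assoc)
  qed
  have sum0: "(\<Sum>i\<in>{1..N+1}. a i) = 0"
  proof -
    have "{1..N} = {1..<k} \<union> {k..N}" "{1..<k} \<inter> {k..N} = {}" using k2 kN by auto
    then have "(\<Sum>i\<in>{1..N}. a i) = (\<Sum>i\<in>{1..<k}. a i) + (\<Sum>i\<in>{k..N}. a i)"
      by (simp only: sum.union_disjoint finite_atLeastLessThan finite_atLeastAtMost)
    then have "(\<Sum>i\<in>{1..N+1}. a i) = (\<Sum>i\<in>{1..<k}. a i) + (\<Sum>i\<in>{k..N}. a i) + a (N+1)"
      by simp
    also have "(\<Sum>i\<in>{1..<k}. a i) = \<epsilon> * (S + n)"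
      using k2 by (simp add: a_def \<epsilon>_def of_nat_diff)
    also have "(\<Sum>i\<in>{k..N}. a i) = - n * \<epsilon>"
      using kN by (simp add: a_def n_def of_nat_diff Suc_diff_le algebra_simps)
    also have "a (N+1) = - s" using kN by (simp add: a_def)
    finally show ?thesis by (simp add: s_def algebra_simps)
  qed
  have a_ge: "a i \<ge> - \<epsilon>" if "i \<in> {1..N}" for i
    using that n \<epsilon> S by (auto simp: a_def)
  have a_le: "a i \<le> S + n" for i
    using n \<epsilon> S s by (auto simp: a_def)
  have "line F \<in> unstable_locus N d"
  proof (rule unstable_if_positive_weights[OF sum0 F_form_tuples F_nonzero])
    fix i m assume i: "i \<in> {1..N+1}" and m: "m \<in> Poly_Mapping.keys (F i)"
    show "mon_weight a m < a i"
    proof (cases "i = N + 1")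
      case True
      have "m = Poly_Mapping.single (N+1) d" using m unfolding True F_last by simp
      moreover have "1 * s < int d * s" using d2 \<epsilon> s by (intro mult_strict_right_mono) auto
      ultimately show ?thesis using True kN by (simp add: a_def)
    next
      case False
      then have i': "i \<in> {1..N}" using i by simp
      from i' m show ?thesis
      proof (cases rule: keys_F)
        case 1
        have "mon_weight a m = a (next_var i) - (int d - 1) * s"
          unfolding 1 using d2 kN by (simp add: a_def of_nat_diff algebra_simps)
        also have "\<dots> < - \<epsilon>" using a_le[of "next_var i"] ds by (simp add: \<epsilon>_def S_def)
        finally show ?thesis using a_ge[OF i'] by simp
      next
        case (2 q)
        have "mon_weight a q = int (mon_degree q) * - \<epsilon>"
          by (rule mon_weight_const) (use 2(2) i' in \<open>auto simp: a_def\<close>)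
        then have "mon_weight a m = - (int (mon_degree q) * \<epsilon>) - (int d - int (mon_degree q)) * s"
          unfolding 2(4) using 2(3) kN by (simp add: a_def of_nat_diff algebra_simps)
        \<comment> \<open>Replacing \<open>s\<close> by the smaller \<open>\<epsilon>\<close>
          weakens the bound but makes it independent of the degree of \<open>q\<close>.\<close>
        also have "\<dots> \<le> - (int (mon_degree q) * \<epsilon>) - (int d - int (mon_degree q)) * \<epsilon>"
          using s 2(3) by (intro diff_left_mono mult_left_mono) auto
        also have "\<dots> = - (int d * \<epsilon>)" by (simp add: algebra_simps)
        also have "\<dots> < - (1 * \<epsilon>)" using d2 \<epsilon> by (intro neg_less_iff_less[THEN iffD2] mult_strict_right_mono) auto
        finally show ?thesis using a_ge[OF i'] by simp
      qed
    qed
  qed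
  then show ?thesis by (simp add: henon_point_def)
qed

lemma henon_point_not_stable:
  assumes "d = 2" "k = 2"
  shows "henon_point N k d b P \<notin> stable_locus N d"
proof -
  \<comment> \<open>Opposite weights on \<open>x_1\<close> and \<open>x_(N+1)\<close> balance
    \<open>x_1 * x_(N+1)\<close> in coordinate \<open>N\<close>. That term and the quadratic terms
    of the \<open>P_j\<close> get weight zero; all other terms get positive weight.\<close>
  define a :: "nat \<Rightarrow> int" where "a = (\<lambda>i. if i = 1 then 1 else if i = N + 1 then - 1 else 0)"
  have N: "N \<ge> 2" using kN assms by simp
  have sum0: "(\<Sum>i\<in>{1..N+1}. a i) = 0"
  proof -
    have "(\<Sum>i\<in>{1..N+1}. a i) = (\<Sum>i\<in>{1..N}. a i) + a (N+1)" by simp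
    also have "(\<Sum>i\<in>{1..N}. a i) = a 1 + (\<Sum>i\<in>{2..N}. a i)"
      using sum.atLeast_Suc_atMost[of 1 N a] N by (simp add: numeral_2_eq_2)
    finally show ?thesis using N by (simp add: a_def)
  qed
  have "line F \<notin> stable_locus N d"
  proof (rule not_stable_if_nonneg_weights[OF sum0, of 1])
    show "1 \<in> {1..N+1}" "a 1 = 1" by (simp_all add: a_def)
    show "F \<in> form_tuples N d" by (rule F_form_tuples)
    fix i m assume i: "i \<in> {1..N+1}" and m: "m \<in> Poly_Mapping.keys (F i)"
    show "mon_weight a m \<le> a i"
    proof (cases "i = N + 1")
      case True
      have "m = Poly_Mapping.single (N+1) d" using m unfolding True F_last by simp
      then show ?thesis using True N assms by (simp add: a_def)
    next
      case False
      then have i': "i \<in> {1..N}" using i by simp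
      from i' m show ?thesis
      proof (cases rule: keys_F)
        case 1
        then show ?thesis using assms N i' by (auto simp: a_def next_var_def)
      next
        case (2 q)
        \<comment> \<open>With \<open>k = 2\<close> the \<open>P_j\<close> avoid both
          \<open>x_1\<close> and \<open>x_(N+1)\<close>, the only variables of nonzero
          weight.\<close>
        have "mon_weight a q = int (mon_degree q) * 0"
          by (rule mon_weight_const) (use 2(2) i' assms in \<open>auto simp: a_def\<close>)
        then show ?thesis unfolding 2(4) using i' N 2(1) assms by (auto simp: a_def)
      qed
    qed
  qed
  then show ?thesis by (simp add: henon_point_def)
qed

end

section \<open>An invariant of quadratic maps\<close>

definition mon2 :: "'v \<Rightarrow> 'v \<Rightarrow> 'v \<Rightarrow>\<^sub>0 nat" where
  "mon2 j k = Poly_Mapping.single j 1 + Poly_Mapping.single k 1"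

text \<open>For a quadratic form this is the second partial derivative in the variables
  \<open>j\<close> and \<open>k\<close>. The factor 2 on the diagonal yields a symmetric Gram matrix
  without division.\<close>

definition hess :: "('v, 'a::comm_ring_1) mpoly \<Rightarrow> 'v \<Rightarrow> 'v \<Rightarrow> 'a" where
  "hess p j k = (if j = k then 2 else 1) * Poly_Mapping.lookup p (mon2 j k)"

lemma mon_degree_mon2 [simp]: "mon_degree (mon2 j k) = 2"
  by (simp add: mon2_def)

lemma keys_mon2: "Poly_Mapping.keys (mon2 j k) = {j, k}"
  by (auto simp: mon2_def in_keys_iff lookup_add lookup_single when_def split: if_splits)

lemma mon2_commute: "mon2 j k = mon2 k j"
  by (simp add: mon2_def add.commute)

lemma mon2_eq_iff: "mon2 j k = mon2 a b \<longleftrightarrow> j = a \<and> k = b \<or> j = b \<and> k = a"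
proof
  assume eq: "mon2 j k = mon2 a b"
  have "Poly_Mapping.lookup (mon2 j k) j = Poly_Mapping.lookup (mon2 a b) j" using eq by simp
  then have "j = a \<or> j = b" by (auto simp: mon2_def lookup_add lookup_single when_def split: if_splits)
  then show "j = a \<and> k = b \<or> j = b \<and> k = a"
  proof
    assume "j = a"
    with eq have "Poly_Mapping.single k (1::nat) = Poly_Mapping.single b 1" by (simp add: mon2_def)
    then have "Poly_Mapping.keys (Poly_Mapping.single k (1::nat)) = Poly_Mapping.keys (Poly_Mapping.single b (1::nat))" by simp
    with \<open>j = a\<close> show ?thesis by simp
  next
    assume "j = b"
    with eq have "mon2 b k = mon2 b a" by (simp only: mon2_commute[of a b])
    then have "Poly_Mapping.single k (1::nat) = Poly_Mapping.single a 1" by (simp add: mon2_def)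
    then have "Poly_Mapping.keys (Poly_Mapping.single k (1::nat)) = Poly_Mapping.keys (Poly_Mapping.single a (1::nat))" by simp
    with \<open>j = b\<close> show ?thesis by simp
  qed
qed (auto simp: mon2_commute)

lemma mon_degree_Suc_split:
  assumes "mon_degree m = Suc n"
  obtains u m' where "m = Poly_Mapping.single u 1 + m'" "mon_degree m' = n"
proof -
  have "m \<noteq> 0" using assms by auto
  then obtain u where u: "u \<in> Poly_Mapping.keys m" by fastforce
  have m: "m = Poly_Mapping.single u 1 + (m - Poly_Mapping.single u 1)"
    using u by (intro poly_mapping_eqI) (auto simp: lookup_add lookup_minus lookup_single when_def in_keys_iff)
  then have "mon_degree m = 1 + mon_degree (m - Poly_Mapping.single u 1)"
    by (metis mon_degree_add mon_degree_single)
  with assms m that show ?thesis by simp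
qed

lemma mon_degree_2_eq_mon2:
  assumes "mon_degree m = 2"
  obtains u v where "m = mon2 u v"
proof -
  obtain u m' where u: "m = Poly_Mapping.single u 1 + m'" "mon_degree m' = 1"
    using mon_degree_Suc_split[of m 1] assms by (auto simp: numeral_2_eq_2)
  obtain v m'' where v: "m' = Poly_Mapping.single v 1 + m''" "mon_degree m'' = 0"
    using mon_degree_Suc_split[of m' 0] u(2) by auto
  show ?thesis using u v that by (simp add: mon2_def)
qed

lemma hess_sum: "hess (sum f S) a b = (\<Sum>s\<in>S. hess (f s) a b)"
  by (simp add: hess_def lookup_sum sum_distrib_left)

lemma hess_mconst_mult: "hess (mconst c * p) a b = c * hess p a b"
  by (simp add: hess_def mult.left_commute)

lemma hess_commute: "hess p a b = hess p b a"
  by (simp add: hess_def mon2_commute)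

lemma hess_mon2:
  "hess (Poly_Mapping.single (mon2 j k) (1::'a::comm_ring_1)) a b =
     (if j = a then 1 else 0) * (if k = b then 1 else 0) + (if j = b then 1 else 0) * (if k = a then 1 else 0)"
  unfolding hess_def lookup_single when_def mon2_eq_iff by auto

lemma mvar_mult_mvar: "mvar j * mvar k = Poly_Mapping.single (mon2 j k) (1::'a::comm_ring_1)"
  by (simp add: mvar_def mult_single mon2_def)

text \<open>The product rule. It settles the substitution into a quadratic monomial, which turns it
  into a product of two linear forms.\<close>

lemma hess_linear_mult_linear:
  fixes \<alpha> \<beta> :: "'v \<Rightarrow> 'a::comm_ring_1"
  assumes I: "finite I" "a \<in> I" "b \<in> I"
  shows "hess ((\<Sum>j\<in>I. mconst (\<alpha> j) * mvar j) * (\<Sum>k\<in>I. mconst (\<beta> k) * mvar k)) a b =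
    \<alpha> a * \<beta> b + \<alpha> b * \<beta> a"
proof -
  have prod: "(mconst (\<alpha> j) * mvar j) * (mconst (\<beta> k) * mvar k) =
      mconst (\<alpha> j * \<beta> k) * Poly_Mapping.single (mon2 j k) 1" for j k
    unfolding mvar_mult_mvar[symmetric] mconst.hom_mult by (simp only: mult_ac)
  have "hess ((\<Sum>j\<in>I. mconst (\<alpha> j) * mvar j) * (\<Sum>k\<in>I. mconst (\<beta> k) * mvar k)) a b =
      (\<Sum>j\<in>I. \<Sum>k\<in>I. \<alpha> j * \<beta> k *
         ((if j = a then 1 else 0) * (if k = b then 1 else 0) + (if j = b then 1 else 0) * (if k = a then 1 else 0)))"
    unfolding sum_product prod hess_sum hess_mconst_mult hess_mon2 ..
  also have "\<dots> = (\<Sum>j\<in>I. (if j = a then \<alpha> a * \<beta> b else 0) + (if j = b then \<alpha> b * \<beta> a else 0))"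
  proof (rule sum.cong[OF refl])
    fix j
    have "(\<Sum>k\<in>I. \<alpha> j * \<beta> k *
         ((if j = a then 1 else 0) * (if k = b then 1 else 0) + (if j = b then 1 else 0) * (if k = a then 1 else 0))) =
       (\<Sum>k\<in>I. if k = b then (if j = a then \<alpha> a * \<beta> b else 0) else 0) +
       (\<Sum>k\<in>I. if k = a then (if j = b then \<alpha> b * \<beta> a else 0) else 0)"
      unfolding sum.distrib[symmetric] by (rule sum.cong) auto
    then show "(\<Sum>k\<in>I. \<alpha> j * \<beta> k *
         ((if j = a then 1 else 0) * (if k = b then 1 else 0) + (if j = b then 1 else 0) * (if k = a then 1 else 0))) =
       (if j = a then \<alpha> a * \<beta> b else 0) + (if j = b then \<alpha> b * \<beta> a else 0)"
      using I by simp
  qed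
  also have "\<dots> = \<alpha> a * \<beta> b + \<alpha> b * \<beta> a"
    using I by (simp add: sum.distrib)
  finally show ?thesis .
qed

text \<open>The chain rule: the Gram matrix changes by congruence with \<open>B\<close>. Both sides
  are linear in \<open>p\<close>, so monomials suffice.\<close>

lemma hess_subst:
  fixes B :: "'a::field mat"
  assumes p: "homogeneous 2 p" "mpoly_vars p \<subseteq> {1..N+1}"
    and ab: "a \<in> {1..N+1}" "b \<in> {1..N+1}"
  shows "hess (mpoly_eval mconst (linear_form N B) p) a b =
    (\<Sum>j\<in>{1..N+1}. \<Sum>k\<in>{1..N+1}. hess p j k * (B $$ (j - 1, a - 1) * B $$ (k - 1, b - 1)))"
proof -
  define I where "I = {1..N+1}"
  have I: "finite I" "a \<in> I" "b \<in> I" using ab by (auto simp: I_def)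
  interpret e: comm_ring_hom "mpoly_eval mconst (linear_form N B)"
    by (rule mconst.comm_ring_hom_mpoly_eval)
  define M where "M = (\<lambda>j k. B $$ (j - 1, a - 1) * B $$ (k - 1, b - 1))"
  have mon: "hess (mpoly_eval mconst (linear_form N B) (Poly_Mapping.single m 1)) a b =
      (\<Sum>j\<in>I. \<Sum>k\<in>I. hess (Poly_Mapping.single m 1) j k * M j k)"
    if m: "m \<in> Poly_Mapping.keys p" for m
  proof -
    have "mon_degree m = 2" using m p(1) by (simp add: homogeneous_def)
    then obtain u v where uv: "m = mon2 u v" by (rule mon_degree_2_eq_mon2)
    have "{u, v} \<subseteq> mpoly_vars p" using m keys_mon2[of u v] unfolding uv mpoly_vars_def by blast
    then have uvI: "u \<in> I" "v \<in> I" using p(2) by (auto simp: I_def)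
    have "hess (mpoly_eval mconst (linear_form N B) (Poly_Mapping.single m 1)) a b = M u v + M v u"
      unfolding uv mvar_mult_mvar[symmetric] e.hom_mult mconst.mpoly_eval_mvar linear_form_def
        I_def[symmetric] hess_linear_mult_linear[OF I] M_def by (simp only: mult.commute)
    also have "\<dots> = (\<Sum>j\<in>I. (if j = u then M u v else 0) + (if j = v then M v u else 0))"
      using I uvI by (simp add: sum.distrib)
    also have "\<dots> = (\<Sum>j\<in>I. \<Sum>k\<in>I. hess (Poly_Mapping.single m 1) j k * M j k)"
    proof (rule sum.cong[OF refl])
      fix j
      have "(\<Sum>k\<in>I. hess (Poly_Mapping.single m 1) j k * M j k) =
         (\<Sum>k\<in>I. if k = v then (if j = u then M u v else 0) else 0) +
         (\<Sum>k\<in>I. if k = u then (if j = v then M v u else 0) else 0)"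
        unfolding sum.distrib[symmetric] uv hess_mon2 by (rule sum.cong) auto
      then show "(if j = u then M u v else 0) + (if j = v then M v u else 0) =
         (\<Sum>k\<in>I. hess (Poly_Mapping.single m 1) j k * M j k)"
        using I uvI by simp
    qed
    finally show ?thesis .
  qed
  define c where "c = Poly_Mapping.lookup p"
  define K where "K = Poly_Mapping.keys p"
  have p_eq: "p = (\<Sum>m\<in>K. mconst (c m) * Poly_Mapping.single m 1)"
    using poly_mapping_eq_sum_single[of p] by (simp add: c_def K_def mconst_mult_single)
  have "hess (mpoly_eval mconst (linear_form N B) p) a b =
      (\<Sum>m\<in>K. c m * (\<Sum>j\<in>I. \<Sum>k\<in>I. hess (Poly_Mapping.single m 1) j k * M j k))"
    by (subst p_eq, unfold e.hom_sum e.hom_mult mconst.mpoly_eval_mconst hess_sum hess_mconst_mult,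
        rule sum.cong[OF refl]) (simp only: mon K_def)
  also have "\<dots> = (\<Sum>m\<in>K. \<Sum>j\<in>I. \<Sum>k\<in>I. c m * hess (Poly_Mapping.single m 1) j k * M j k)"
    by (simp only: sum_distrib_left mult.assoc)
  also have "\<dots> = (\<Sum>j\<in>I. \<Sum>k\<in>I. \<Sum>m\<in>K. c m * hess (Poly_Mapping.single m 1) j k * M j k)"
    by (subst sum.swap, rule sum.cong[OF refl], rule sum.swap)
  also have "\<dots> = (\<Sum>j\<in>I. \<Sum>k\<in>I. hess p j k * M j k)"
    by (intro sum.cong refl, subst p_eq) (simp only: hess_sum hess_mconst_mult sum_distrib_right)
  finally show ?thesis by (simp only: I_def M_def)
qed

text \<open>Up to scalars, \<open>div_form F\<close> is the divergence of \<open>F\<close>, a linear form, and \<open>quad_form F\<close>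
  is its composition with \<open>F\<close>, a quadratic form. Both are equivariant under conjugation,
  so the discriminant of the latter is invariant.\<close>

definition div_form :: "nat \<Rightarrow> 'a::comm_ring_1 tuple \<Rightarrow> nat \<Rightarrow> 'a" where
  "div_form N F j = (\<Sum>i\<in>{1..N+1}. hess (F i) i j)"

definition quad_form :: "nat \<Rightarrow> 'a::comm_ring_1 tuple \<Rightarrow> nat \<Rightarrow> nat \<Rightarrow> 'a" where
  "quad_form N F a b = (\<Sum>i\<in>{1..N+1}. div_form N F i * hess (F i) a b)"

definition quad_mat :: "nat \<Rightarrow> 'a::comm_ring_1 tuple \<Rightarrow> 'a mat" where
  "quad_mat N F = mat (N+1) (N+1) (\<lambda>(a, b). quad_form N F (a + 1) (b + 1))"

text \<open>Contracting an upper index, moved by \<open>A\<close>, with a lower one, moved by the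
  inverse \<open>B\<close>, cancels the two matrices, as in the invariance of the trace. It is
  applied once to the divergence and once to its composition with the map.\<close>

lemma sum_contract:
  fixes A B y :: "'i \<Rightarrow> 'i \<Rightarrow> 'a::comm_ring_1"
  assumes "finite I"
    and "\<And>p j. p \<in> I \<Longrightarrow> j \<in> I \<Longrightarrow> (\<Sum>i\<in>I. B p i * A i j) = (if p = j then 1 else 0)"
  shows "(\<Sum>i\<in>I. \<Sum>j\<in>I. \<Sum>p\<in>I. A i j * (B p i * y j p)) = (\<Sum>j\<in>I. y j j)"
proof -
  have "(\<Sum>i\<in>I. \<Sum>j\<in>I. \<Sum>p\<in>I. A i j * (B p i * y j p)) =
      (\<Sum>j\<in>I. \<Sum>p\<in>I. \<Sum>i\<in>I. A i j * (B p i * y j p))"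
    by (subst sum.swap, rule sum.cong[OF refl], rule sum.swap)
  also have "\<dots> = (\<Sum>j\<in>I. \<Sum>p\<in>I. (\<Sum>i\<in>I. B p i * A i j) * y j p)"
    by (simp only: sum_distrib_left sum_distrib_right mult_ac)
  also have "\<dots> = (\<Sum>j\<in>I. \<Sum>p\<in>I. if p = j then y j j else 0)"
    by (intro sum.cong refl) (simp add: assms(2))
  also have "\<dots> = (\<Sum>j\<in>I. y j j)" using assms(1) by simp
  finally show ?thesis .
qed

text \<open>The Hessian coefficients form a tensor with one upper and two lower indices. Two
  contractions remove every occurrence of \<open>A\<close>, leaving the congruence of
  \<open>quad_mat N F\<close> by the inverse of \<open>A\<close>, whose determinant is 1.\<close>

lemma det_quad_mat_conj_action:
  fixes A :: "'a::field mat"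
  assumes A: "A \<in> SL (N+1)" and F: "F \<in> form_tuples N 2"
  shows "det (quad_mat N (conj_action N A F)) = det (quad_mat N F)"
proof -
  define Bm where "Bm = the (mat_inverse A)"
  have carr: "A \<in> carrier_mat (N+1) (N+1)" "Bm \<in> carrier_mat (N+1) (N+1)"
    and BA: "Bm * A = 1\<^sub>m (N+1)" and detB: "det Bm = 1"
    using A SL_mat_inverse[OF A] by (auto simp: SL_def Bm_def)
  define I where "I = {1..N+1}"
  define \<alpha> where "\<alpha> = (\<lambda>i j. A $$ (i - 1, j - 1))"
  define \<beta> where "\<beta> = (\<lambda>i j. Bm $$ (i - 1, j - 1))"
  define h where "h = (\<lambda>j p q. hess (F j) p q)"
  define h' where "h' = (\<lambda>j p q. hess (conj_action N A F j) p q)"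
  have fin: "finite I" by (simp add: I_def)
  have inv: "(\<Sum>i\<in>I. \<beta> p i * \<alpha> i j) = (if p = j then 1 else 0)" if "p \<in> I" "j \<in> I" for p j
  proof -
    have "(\<Sum>i\<in>I. \<beta> p i * \<alpha> i j) = (Bm * A) $$ (p - 1, j - 1)"
      using that unfolding \<alpha>_def \<beta>_def I_def by (intro index_mult_mat_shifted[symmetric] carr)
    then show ?thesis using that unfolding BA I_def by auto
  qed
  have h': "h' i a b = (\<Sum>j\<in>I. \<alpha> i j * (\<Sum>p\<in>I. \<Sum>q\<in>I. h j p q * (\<beta> p a * \<beta> q b)))"
    if "i \<in> I" "a \<in> I" "b \<in> I" for i a b
  proof -
    have hom: "homogeneous 2 (F j)" "mpoly_vars (F j) \<subseteq> {1..N+1}" if "j \<in> I" for j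
      using F that unfolding form_tuples_def I_def by auto
    have "h' i a b = (\<Sum>j\<in>I. \<alpha> i j * hess (mpoly_eval mconst (linear_form N Bm) (F j)) a b)"
      using that(1) unfolding h'_def conj_action_def I_def Bm_def \<alpha>_def
      by (simp only: if_True hess_sum hess_mconst_mult)
    also have "\<dots> = (\<Sum>j\<in>I. \<alpha> i j * (\<Sum>p\<in>I. \<Sum>q\<in>I. h j p q * (\<beta> p a * \<beta> q b)))"
    proof (rule sum.cong[OF refl])
      fix j assume j: "j \<in> I"
      show "\<alpha> i j * hess (mpoly_eval mconst (linear_form N Bm) (F j)) a b =
          \<alpha> i j * (\<Sum>p\<in>I. \<Sum>q\<in>I. h j p q * (\<beta> p a * \<beta> q b))"
        unfolding hess_subst[OF hom[OF j] that(2,3)[unfolded I_def]] I_def \<beta>_def h_def ..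
    qed
    finally show ?thesis .
  qed
  have div: "div_form N (conj_action N A F) b = (\<Sum>q\<in>I. div_form N F q * \<beta> q b)" if b: "b \<in> I" for b
  proof -
    have "div_form N (conj_action N A F) b = (\<Sum>i\<in>I. h' i i b)"
      by (simp only: div_form_def h'_def I_def)
    also have "\<dots> = (\<Sum>i\<in>I. \<Sum>j\<in>I. \<Sum>p\<in>I. \<alpha> i j * (\<beta> p i * (\<Sum>q\<in>I. h j p q * \<beta> q b)))"
      by (intro sum.cong refl) (simp only: h' b sum_distrib_left mult_ac)
    also have "\<dots> = (\<Sum>j\<in>I. \<Sum>q\<in>I. h j j q * \<beta> q b)"
      by (rule sum_contract[OF fin inv])
    also have "\<dots> = (\<Sum>q\<in>I. \<Sum>j\<in>I. h j j q * \<beta> q b)" by (rule sum.swap)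
    also have "\<dots> = (\<Sum>q\<in>I. div_form N F q * \<beta> q b)"
      by (simp only: div_form_def h_def I_def sum_distrib_right)
    finally show ?thesis .
  qed
  have quad: "quad_form N (conj_action N A F) a b = (\<Sum>p\<in>I. \<beta> p a * (\<Sum>q\<in>I. quad_form N F p q * \<beta> q b))"
    if ab: "a \<in> I" "b \<in> I" for a b
  proof -
    define z where "z = (\<lambda>j. \<Sum>p\<in>I. \<Sum>q\<in>I. h j p q * (\<beta> p a * \<beta> q b))"
    have "quad_form N (conj_action N A F) a b = (\<Sum>i\<in>I. div_form N (conj_action N A F) i * h' i a b)"
      by (simp only: quad_form_def h'_def I_def)
    also have "\<dots> = (\<Sum>i\<in>I. (\<Sum>j\<in>I. \<alpha> i j * z j) * (\<Sum>q\<in>I. div_form N F q * \<beta> q i))"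
      by (intro sum.cong refl) (simp only: div h' ab z_def mult.commute)
    also have "\<dots> = (\<Sum>i\<in>I. \<Sum>j\<in>I. \<Sum>p\<in>I. \<alpha> i j * (\<beta> p i * (div_form N F p * z j)))"
      by (simp only: sum_product mult_ac)
    also have "\<dots> = (\<Sum>j\<in>I. div_form N F j * z j)"
      by (rule sum_contract[OF fin inv])
    also have "\<dots> = (\<Sum>j\<in>I. \<Sum>p\<in>I. \<Sum>q\<in>I. \<beta> p a * ((div_form N F j * h j p q) * \<beta> q b))"
      unfolding z_def by (simp only: sum_distrib_left mult_ac)
    also have "\<dots> = (\<Sum>p\<in>I. \<Sum>q\<in>I. \<Sum>j\<in>I. \<beta> p a * ((div_form N F j * h j p q) * \<beta> q b))"
      by (subst sum.swap, rule sum.cong[OF refl], rule sum.swap)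
    also have "\<dots> = (\<Sum>p\<in>I. \<beta> p a * (\<Sum>q\<in>I. quad_form N F p q * \<beta> q b))"
      by (simp only: quad_form_def h_def I_def sum_distrib_left sum_distrib_right)
    finally show ?thesis .
  qed
  have qm: "quad_mat N G \<in> carrier_mat (N+1) (N+1)" for G :: "'a tuple"
    by (simp add: quad_mat_def)
  have qm_index: "quad_mat N G $$ (i - 1, j - 1) = quad_form N G i j" if "i \<in> I" "j \<in> I" for G :: "'a tuple" and i j
    using that by (auto simp: quad_mat_def I_def)
  have "quad_mat N (conj_action N A F) = transpose_mat Bm * (quad_mat N F * Bm)"
  proof (rule eq_matI)
    fix i j assume "i < dim_row (transpose_mat Bm * (quad_mat N F * Bm))"
      "j < dim_col (transpose_mat Bm * (quad_mat N F * Bm))"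
    then have ij: "i < N + 1" "j < N + 1" using carr by auto
    then have ij': "i + 1 \<in> I" "j + 1 \<in> I" by (auto simp: I_def)
    have "quad_mat N (conj_action N A F) $$ (i, j) = quad_form N (conj_action N A F) (i + 1) (j + 1)"
      using ij by (simp add: quad_mat_def)
    also have "\<dots> = (\<Sum>p\<in>I. transpose_mat Bm $$ (i + 1 - 1, p - 1) * (quad_mat N F * Bm) $$ (p - 1, j + 1 - 1))"
      unfolding quad[OF ij']
    proof (rule sum.cong[OF refl])
      fix p assume p: "p \<in> I"
      have "transpose_mat Bm $$ (i + 1 - 1, p - 1) = \<beta> p (i + 1)"
        using p ij carr by (auto simp: \<beta>_def I_def)
      moreover have "(quad_mat N F * Bm) $$ (p - 1, j + 1 - 1) = (\<Sum>q\<in>I. quad_form N F p q * \<beta> q (j + 1))"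
        unfolding index_mult_mat_shifted[OF qm carr(2) p[unfolded I_def] ij'(2)[unfolded I_def]]
        unfolding I_def[symmetric] by (intro sum.cong refl) (simp only: qm_index p \<beta>_def)
      ultimately show "\<beta> p (i + 1) * (\<Sum>q\<in>I. quad_form N F p q * \<beta> q (j + 1)) =
          transpose_mat Bm $$ (i + 1 - 1, p - 1) * (quad_mat N F * Bm) $$ (p - 1, j + 1 - 1)"
        by (simp only:)
    qed
    also have "\<dots> = (transpose_mat Bm * (quad_mat N F * Bm)) $$ (i + 1 - 1, j + 1 - 1)"
      unfolding I_def
      by (rule index_mult_mat_shifted[symmetric]) (use carr qm[of F] ij' in \<open>auto simp: I_def\<close>)
    finally show "quad_mat N (conj_action N A F) $$ (i, j) = (transpose_mat Bm * (quad_mat N F * Bm)) $$ (i, j)"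
      by simp
  qed (use carr in \<open>auto simp: quad_mat_def\<close>)
  then show ?thesis
    using carr qm[of F] detB by (simp add: det_mult[of _ "N+1"] det_transpose)
qed

section \<open>The discriminant as a polynomial in the coefficients\<close>

definition hess_coord :: "nat \<Rightarrow> nat \<Rightarrow> nat \<Rightarrow> 'a::field coord_poly" where
  "hess_coord i j k = mconst (if j = k then 2 else 1) * mvar (i, mon2 j k)"

definition quad_coord :: "nat \<Rightarrow> nat \<Rightarrow> nat \<Rightarrow> 'a::field coord_poly" where
  "quad_coord N a b = (\<Sum>i\<in>{1..N+1}. (\<Sum>l\<in>{1..N+1}. hess_coord l l i) * hess_coord i a b)"

text \<open>The generic counterpart of \<open>det (quad_mat N F)\<close>, with independent variables
  in place of the coefficients of \<open>F\<close>.\<close>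

definition disc_coord :: "nat \<Rightarrow> 'a::field coord_poly" where
  "disc_coord N = det (mat (N+1) (N+1) (\<lambda>(a, b). quad_coord N (a + 1) (b + 1)))"

lemma value_at_disc_coord:
  fixes F :: "'a::field tuple"
  shows "value_at (disc_coord N) F = det (quad_mat N F)"
proof -
  interpret i: comm_ring_hom "id :: 'a \<Rightarrow> 'a" by (rule comm_ring_hom_id)
  interpret e: comm_ring_hom "\<lambda>J. value_at J F"
    unfolding value_at_def by (rule i.comm_ring_hom_mpoly_eval)
  have hess: "value_at (hess_coord i j k) F = hess (F i) j k" for i j k
    unfolding hess_coord_def e.hom_mult unfolding value_at_def i.mpoly_eval_mconst i.mpoly_eval_mvar
    by (simp add: hess_def)
  have "value_at (quad_coord N a b) F = quad_form N F a b" for a b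
    unfolding quad_coord_def quad_form_def div_form_def e.hom_sum e.hom_mult hess ..
  then show ?thesis
    unfolding disc_coord_def e.hom_det[symmetric] quad_mat_def
    by (intro arg_cong[where f = det] eq_matI) auto
qed

lemma homogeneous_prod:
  fixes f :: "'i \<Rightarrow> ('v, 'a::comm_ring_1) mpoly"
  assumes "finite S" "\<And>s. s \<in> S \<Longrightarrow> homogeneous e (f s)"
  shows "homogeneous (card S * e) (prod f S)"
  using assms
proof (induction S rule: finite_induct)
  case empty
  show ?case by (simp add: homogeneous_def)
next
  case (insert s S)
  then show ?case by (auto intro!: homogeneous_mult)
qed

lemma mpoly_vars_prod:
  fixes f :: "'i \<Rightarrow> ('v, 'a::comm_ring_1) mpoly"
  assumes "finite S" "\<And>s. s \<in> S \<Longrightarrow> mpoly_vars (f s) \<subseteq> X"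
  shows "mpoly_vars (prod f S) \<subseteq> X"
  using assms
proof (induction S rule: finite_induct)
  case empty
  show ?case by (simp add: mpoly_vars_def)
next
  case (insert s S)
  have "mpoly_vars (f s * prod f S) \<subseteq> mpoly_vars (f s) \<union> mpoly_vars (prod f S)"
    by (rule mpoly_vars_mult)
  also have "\<dots> \<subseteq> X" using insert by auto
  finally show ?case using insert by simp
qed

lemma homogeneous_det:
  fixes M :: "('v, 'a::comm_ring_1) mpoly mat"
  assumes M: "M \<in> carrier_mat n n" "\<And>i j. i < n \<Longrightarrow> j < n \<Longrightarrow> homogeneous e (M $$ (i, j))"
  shows "homogeneous (n * e) (det M)"
  unfolding det_def'[OF M(1)]
proof (rule homogeneous_sum)
  fix p assume "p \<in> {p. p permutes {0..<n}}"
  then have p: "p i < n" if "i < n" for i using that permutes_in_image[of p "{0..<n}" i] by simp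
  have "homogeneous (card {0..<n} * e) (\<Prod>i = 0..<n. M $$ (i, p i))"
    by (rule homogeneous_prod) (use M(2) p in auto)
  \<comment> \<open>The sign is read as a constant polynomial, so it contributes degree 0.\<close>
  from homogeneous_mult[OF homogeneous_mconst[of "signof p"] this]
  show "homogeneous (n * e) (signof p * (\<Prod>i = 0..<n. M $$ (i, p i)))"
    by (simp only: mconst.hom_signof add_0 card_atLeastLessThan diff_zero)
qed

lemma mpoly_vars_det:
  fixes M :: "('v, 'a::comm_ring_1) mpoly mat"
  assumes M: "M \<in> carrier_mat n n" "\<And>i j. i < n \<Longrightarrow> j < n \<Longrightarrow> mpoly_vars (M $$ (i, j)) \<subseteq> X"
  shows "mpoly_vars (det M) \<subseteq> X"
proof -
  have "mpoly_vars (signof p * (\<Prod>i = 0..<n. M $$ (i, p i))) \<subseteq> X" if "p permutes {0..<n}" for p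
  proof -
    have p: "p i < n" if "i < n" for i
      using that permutes_in_image[OF \<open>p permutes {0..<n}\<close>, of i] by simp
    have "mpoly_vars (\<Prod>i = 0..<n. M $$ (i, p i)) \<subseteq> X"
      by (rule mpoly_vars_prod) (use M(2) p in auto)
    then have "mpoly_vars (mconst (signof p) * (\<Prod>i = 0..<n. M $$ (i, p i))) \<subseteq> X"
      by (intro subset_trans[OF mpoly_vars_mult] Un_least) (simp_all only: mpoly_vars_mconst empty_subsetI)
    then show ?thesis by (simp only: mconst.hom_signof)
  qed
  then show ?thesis
    unfolding det_def'[OF M(1)]
    by (intro subset_trans[OF mpoly_vars_sum] UN_least) auto
qed

lemma homogeneous_hess_coord: "homogeneous 1 (hess_coord i j k)"
  unfolding hess_coord_def using homogeneous_mult[OF homogeneous_mconst homogeneous_mvar]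
  by (simp only: add_0)

lemma homogeneous_disc_coord: "homogeneous ((N + 1) * 2) (disc_coord N)"
  unfolding disc_coord_def
proof (rule homogeneous_det)
  have "homogeneous (1 + 1) (quad_coord N a b)" for a b
    unfolding quad_coord_def
    by (intro homogeneous_sum homogeneous_mult homogeneous_hess_coord)
  then show "homogeneous 2 (mat (N + 1) (N + 1) (\<lambda>(a, b). quad_coord N (a + 1) (b + 1)) $$ (i, j))"
    if "i < N + 1" "j < N + 1" for i j
    using that by (simp add: numeral_2_eq_2)
qed simp

lemma disc_coord_in_coord_polys: "disc_coord N \<in> coord_polys N 2"
proof -
  define I where "I = {1..N+1}"
  define X where "X = I \<times> {m. Poly_Mapping.keys m \<subseteq> I \<and> mon_degree m = 2}"
  have h: "mpoly_vars (hess_coord i j k) \<subseteq> X" if "i \<in> I" "j \<in> I" "k \<in> I" for i j k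
  proof -
    have "mpoly_vars (hess_coord i j k) \<subseteq> {(i, mon2 j k)}"
      unfolding hess_coord_def by (rule subset_trans[OF mpoly_vars_mult]) simp
    also have "\<dots> \<subseteq> X" using that by (simp add: X_def keys_mon2)
    finally show ?thesis .
  qed
  have q: "mpoly_vars (quad_coord N a b) \<subseteq> X" if "a \<in> I" "b \<in> I" for a b
  proof -
    have "mpoly_vars ((\<Sum>l\<in>I. hess_coord l l i) * hess_coord i a b) \<subseteq> X" if "i \<in> I" for i
      by (intro subset_trans[OF mpoly_vars_mult] Un_least subset_trans[OF mpoly_vars_sum] UN_least
          h \<open>a \<in> I\<close> \<open>b \<in> I\<close> that)
    then show ?thesis
      unfolding quad_coord_def I_def[symmetric]
      by (intro subset_trans[OF mpoly_vars_sum] UN_least)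
  qed
  have "mpoly_vars (disc_coord N) \<subseteq> X"
    unfolding disc_coord_def
  proof (rule mpoly_vars_det)
    fix i j assume ij: "i < N + 1" "j < N + 1"
    then have "i + 1 \<in> I" "j + 1 \<in> I" by (auto simp: I_def)
    from q[OF this] show "mpoly_vars (mat (N + 1) (N + 1) (\<lambda>(a, b). quad_coord N (a + 1) (b + 1)) $$ (i, j)) \<subseteq> X"
      using ij by simp
  qed simp
  then show ?thesis by (simp only: coord_polys_def X_def I_def mem_Collect_eq)
qed

lemma semistable_if_det_quad_mat_nonzero:
  fixes F :: "'a::field tuple"
  assumes F: "F \<in> form_tuples N 2" and det: "det (quad_mat N F) \<noteq> 0"
  shows "line F \<in> semistable_locus N 2"
proof -
  let ?J = "disc_coord N :: 'a coord_poly"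
  \<comment> \<open>The discriminant is 0 at the zero tuple but not at \<open>F\<close>; this
    contrast shows both that it is not constant and that \<open>F\<close> is not zero.\<close>
  have scale: "value_at ?J (\<lambda>i. mconst 0 * F i) = 0"
    unfolding value_at_scale[OF homogeneous_disc_coord] by simp
  have val: "value_at ?J F \<noteq> 0" using det by (simp add: value_at_disc_coord)
  have nonconst: "\<nexists>c. ?J = mconst c"
  proof
    assume "\<exists>c. ?J = mconst c"
    then obtain c where "?J = mconst c" ..
    then have "value_at ?J G = c" for G by (simp add: value_at_def mpoly_eval_def mconst_def)
    with scale val show False by simp
  qed
  have "F \<noteq> (\<lambda>_. 0)"
  proof
    assume "F = (\<lambda>_. 0)"
    then have "(\<lambda>i. mconst 0 * F i) = F" by (simp add: fun_eq_iff)
    with scale val show False by simp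
  qed
  then have "line F \<in> proj_space N 2" using F unfolding proj_space_def by blast
  moreover have "\<not> vanishes_at ?J (line F)" using val line_self unfolding vanishes_at_def by blast
  moreover have "SL_invariant N 2 ?J"
    unfolding SL_invariant_def by (simp add: value_at_disc_coord det_quad_mat_conj_action)
  ultimately show ?thesis
    unfolding semistable_locus_def
    using disc_coord_in_coord_polys homogeneous_disc_coord nonconst by blast
qed

text \<open>Exchanging the first and the last row makes the matrix upper triangular and only changes
  the sign of the determinant.\<close>

lemma det_anti_triangular_nonzero:
  fixes M :: "'a::field mat"
  assumes M: "M \<in> carrier_mat 3 3"
    and "M $$ (0, 0) = 0" "M $$ (0, 1) = 0" "M $$ (1, 0) = 0"
    and "M $$ (0, 2) \<noteq> 0" "M $$ (1, 1) \<noteq> 0" "M $$ (2, 0) \<noteq> 0"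
  shows "det M \<noteq> 0"
proof -
  let ?\<pi> = "Transposition.transpose 0 (2::nat)"
  let ?M = "mat 3 3 (\<lambda>(i, j). M $$ (?\<pi> i, j))"
  have "?\<pi> permutes {0..<3}" by (rule permutes_swap_id) auto
  then have "det ?M = signof ?\<pi> * det M" by (rule det_permute_rows[OF M])
  moreover have "det ?M = prod_list (diag_mat ?M)"
  proof (rule det_upper_triangular[where n = 3])
    have "?M $$ (i, j) = 0" if "j < i" "i < 3" for i j
    proof -
      have "i = 1 \<and> j = 0 \<or> i = 2 \<and> j = 0 \<or> i = 2 \<and> j = 1" using that by auto
      then show ?thesis using assms by (auto simp: Transposition.transpose_def)
    qed
    then show "upper_triangular ?M" by (auto simp: upper_triangular_def)
  qed simp
  moreover have "prod_list (diag_mat ?M) = M $$ (2, 0) * M $$ (1, 1) * M $$ (0, 2)"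
  proof -
    have "{0..<3} = {0, 1, 2::nat}" by auto
    then show ?thesis by (simp add: prod_list_diag_prod Transposition.transpose_def)
  qed
  ultimately show ?thesis using assms by auto
qed

section \<open>Semistability of the quadratic Henon map of the plane\<close>

context henon
begin

text \<open>Here \<open>F\<close> is \<open>b_2 x_2 x_3\<close>, then
  \<open>b_1 x_1 x_3 + p x_2^2\<close> plus terms in \<open>x_2 x_3\<close> and
  \<open>x_3^2\<close>, then \<open>x_3^2\<close>. Its divergence has no \<open>x_1\<close> part and
  \<open>x_2\<close> coefficient \<open>2 * p\<close>, so outside the entry at (3,3) the Gram matrix
  is \<open>2 * p\<close> times that of \<open>F 2\<close>. The antidiagonal is
  \<open>2 * p * b 1\<close>, \<open>4 * p * p\<close>, \<open>2 * p * b 1\<close>.\<close>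

lemma henon_point_semistable:
  assumes dkN: "d = 2" "k = 2" "N = 2"
  shows "henon_point N k d b P \<in> semistable_locus N d"
proof -
  define p where "p = Poly_Mapping.lookup (P 3) (mon2 2 2)"
  have P3_vars: "mpoly_vars (P 3) \<subseteq> {2}" using P_vars[of 2] dkN by simp
  have P3_keys: "Poly_Mapping.lookup (P 3) m = 0" if "1 \<in> Poly_Mapping.keys m" for m
  proof (rule ccontr)
    assume "Poly_Mapping.lookup (P 3) m \<noteq> 0"
    then have "1 \<in> mpoly_vars (P 3)" using that by (auto simp: mpoly_vars_def in_keys_iff)
    with P3_vars show False by auto
  qed
  \<comment> \<open>\<open>P 3\<close> involves only \<open>x_2\<close>, so its monomial of degree 2
    can only be the square of \<open>x_2\<close>.\<close>
  have p: "p \<noteq> 0"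
  proof -
    have "total_degree (P 3) = 2" using P_degree dkN by simp
    then obtain m where m: "m \<in> Poly_Mapping.keys (P 3)" "mon_degree m = 2"
      using total_degree_attained[of "P 3"] by auto
    obtain u v where uv: "m = mon2 u v" using m(2) by (rule mon_degree_2_eq_mon2)
    have "{u, v} \<subseteq> mpoly_vars (P 3)" using m(1) keys_mon2[of u v] unfolding uv mpoly_vars_def by blast
    with P3_vars have "u = 2" "v = 2" by auto
    with m(1) uv show ?thesis by (simp add: p_def in_keys_iff)
  qed
  have F1: "hess (F 1) i j = 0" if "mon2 i j \<noteq> mon2 2 3" for i j
  proof -
    have "mon2 i j \<notin> Poly_Mapping.keys (F 1)"
    proof
      have "1 \<in> {1..N}" using dkN by simp
      moreover assume "mon2 i j \<in> Poly_Mapping.keys (F 1)"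
      ultimately show False
      proof (cases rule: keys_F)
        case 1
        moreover have "next_var 1 = 2" "N + 1 = 3" "d - 1 = 1" unfolding next_var_def using dkN by simp_all
        ultimately have "mon2 i j = mon2 2 3" by (simp only: mon2_def[of 2 3])
        with that show ?thesis by simp
      next
        case (2 n)
        then show ?thesis using dkN by simp
      qed
    qed
    then show ?thesis by (simp add: hess_def in_keys_iff)
  qed
  have F3: "hess (F 3) i j = 0" if "mon2 i j \<noteq> mon2 3 3" for i j
  proof -
    have "F 3 = Poly_Mapping.single (Poly_Mapping.single 3 2) 1" using F_last dkN by simp
    moreover have "Poly_Mapping.single 3 2 = mon2 3 (3::nat)"
      by (simp add: mon2_def single_add[symmetric] numeral_2_eq_2)
    ultimately show ?thesis using that by (simp add: hess_def lookup_single when_def)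
  qed
  have F2: "Poly_Mapping.lookup (F 2) (m + Poly_Mapping.single 3 (2 - mon_degree m)) =
      b 1 * Poly_Mapping.lookup (mvar 1) m + Poly_Mapping.lookup (P 3) m"
    if "Poly_Mapping.keys m \<subseteq> {1..2}" for m
  proof -
    have "Poly_Mapping.lookup (F 2) (m + Poly_Mapping.single 3 (2 - mon_degree m)) =
        Poly_Mapping.lookup (henon_affine N k b P 2) m"
      using lookup_F[of 2 m] that dkN by simp
    then show ?thesis using dkN by (simp add: henon_affine_def lookup_add)
  qed
  have F2_quad: "Poly_Mapping.lookup (F 2) (mon2 i j) = Poly_Mapping.lookup (P 3) (mon2 i j)"
    if "i \<in> {1..2}" "j \<in> {1..2}" for i j
  proof -
    have "mon2 i j \<noteq> Poly_Mapping.single 1 1"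
    proof
      assume "mon2 i j = Poly_Mapping.single 1 1"
      then have "mon_degree (mon2 i j) = mon_degree (Poly_Mapping.single (1::nat) 1)" by (rule arg_cong)
      then show False by simp
    qed
    then have "Poly_Mapping.lookup (mvar 1) (mon2 i j) = (0 :: 'a)"
      by (simp add: mvar_def lookup_single when_def)
    then show ?thesis using F2[of "mon2 i j"] that by (simp add: keys_mon2)
  qed
  have F2_12: "hess (F 2) 1 j = 0" if "j \<in> {1..2}" for j
    using that F2_quad[of 1 j] P3_keys[of "mon2 1 j"] by (simp add: hess_def keys_mon2)
  then have F2_21: "hess (F 2) 2 1 = 0" by (subst hess_commute) simp
  have F2_22: "hess (F 2) 2 2 = 2 * p"
    using F2_quad[of 2 2] by (simp add: hess_def p_def)
  have F2_13: "hess (F 2) 1 3 = b 1"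
    using F2[of "Poly_Mapping.single 1 1"] P3_keys[of "Poly_Mapping.single 1 1"]
    by (simp add: hess_def mon2_def mvar_def)
  then have F2_31: "hess (F 2) 3 1 = b 1" by (subst hess_commute)
  have sum3: "(\<Sum>i\<in>{1..N+1}. f i) = f 1 + f 2 + f 3" for f :: "nat \<Rightarrow> 'a"
  proof -
    have "{1..N+1} = {1, 2, 3}" using dkN by auto
    then show ?thesis by simp
  qed
  have div1: "div_form N F 1 = 0"
    unfolding div_form_def sum3
    using F1[of 1 1] F2_21 F3[of 3 1] by (simp add: mon2_eq_iff)
  have div2: "div_form N F 2 = 2 * p"
    unfolding div_form_def sum3
    using F1[of 1 2] F2_22 F3[of 3 2] by (simp add: mon2_eq_iff)
  \<comment> \<open>\<open>div_form N F 3\<close> multiplies only \<open>F 3\<close>, the square of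
    \<open>x_3\<close>, and so affects the entry at (3,3) alone; \<open>F 1\<close> drops out
    because \<open>div_form N F 1\<close> is 0.\<close>
  have quad: "quad_form N F i j = 2 * p * hess (F 2) i j" if "mon2 i j \<noteq> mon2 3 3" for i j
    unfolding quad_form_def sum3 div1 div2 F3[OF that] by simp
  have "det (quad_mat N F) \<noteq> 0"
  proof (rule det_anti_triangular_nonzero)
    show "quad_mat N F \<in> carrier_mat 3 3" using dkN by (simp add: quad_mat_def)
    have idx: "quad_mat N F $$ (i - 1, j - 1) = quad_form N F i j" if "i \<in> {1..3}" "j \<in> {1..3}" for i j
      using that dkN by (auto simp: quad_mat_def)
    have q: "quad_form N F 1 1 = 0" "quad_form N F 1 2 = 0" "quad_form N F 2 1 = 0"
      "quad_form N F 1 3 = 2 * p * b 1" "quad_form N F 2 2 = 4 * p * p" "quad_form N F 3 1 = 2 * p * b 1"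
      using quad[of 1 1] quad[of 1 2] quad[of 2 1] quad[of 1 3] quad[of 2 2] quad[of 3 1]
        F2_12[of 1] F2_12[of 2] F2_21 F2_22 F2_13 F2_31
      by (simp_all add: mon2_eq_iff)
    have b1: "b 1 \<noteq> 0" using b_nonzero[of 1] dkN by simp
    show "quad_mat N F $$ (0, 0) = 0" "quad_mat N F $$ (0, 1) = 0" "quad_mat N F $$ (1, 0) = 0"
      "quad_mat N F $$ (0, 2) \<noteq> 0" "quad_mat N F $$ (1, 1) \<noteq> 0" "quad_mat N F $$ (2, 0) \<noteq> 0"
      using q p b1 idx[of 1 1] idx[of 1 2] idx[of 2 1] idx[of 1 3] idx[of 2 2] idx[of 3 1]
      by simp_all
  qed
  then show ?thesis
    unfolding henon_point_def using semistable_if_det_quad_mat_nonzero F_form_tuples dkN by simp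
qed

end

theorem theorem1p2:
  fixes N k d :: nat
    and b :: "nat \<Rightarrow> 'a::{alg_closed_field, field_char_0}"
    and P :: "nat \<Rightarrow> (nat, 'a) mpoly"
  assumes "k \<ge> 2" and "N \<ge> k" and "d \<ge> 2"
    and "\<And>j. j \<in> {1..N} \<Longrightarrow> b j \<noteq> 0"
    and "\<And>i. i \<in> {k..N} \<Longrightarrow> mpoly_vars (P (i+1)) \<subseteq> {k..i}"
    and "Max ((\<lambda>i. total_degree (P (i+1))) ` {k..N}) = d"
  shows "(d \<ge> 3 \<or> k \<ge> 3 \<longrightarrow> henon_point N k d b P \<in> Rat_space N d \<inter> unstable_locus N d) \<and>
         (d = 2 \<and> k = 2 \<longrightarrow> henon_point N k d b P \<in> Rat_space N d - stable_locus N d) \<and>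
         (d = 2 \<and> k = 2 \<and> N = 2 \<longrightarrow>
            henon_point N k d b P \<in> Rat_space N d \<inter> semistable_locus N d)"
proof -
  interpret henon N k d b P
    by unfold_locales (use assms in auto)
  show ?thesis
    using henon_point_Rat_space henon_point_unstable henon_point_not_stable henon_point_semistable
    by blast
qed

end
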